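(* Run the algorithm RPOSST$_{\mathrm{SEQ}}$ (defined in the context) with inputs $k,N,T_1,m,\Psi,\tau^0,\ell,T_2$. After $T'\sim\mathrm{Unif}(\{1,\dots,T_1\})$, $T_1>0$, rounds of its optimization game, the algorithm selects an $m$-tuple of test cases $\tau^*$ and weights $\hat\sigma^{T'}_{\tau^*}\in\triangle^m$ that, with probability at least $(1-p)(1-q)(1-\alpha)$, where $p,q,\alpha>0$, are $\frac{\varepsilon}{q}$-optimal for $$\min_{\tau\in\mathcal T^m,\ \hat\sigma_\tau\in\triangle^m} L_{\mu_{k\text{-of-}N},\Psi}(\hat\sigma_\tau),$$ i.e. $L_{\mu_{k\text{-of-}N},\Psi}(\hat\sigma^{T'}_{\tau^*})$ exceeds this minimum by at most $\frac{\varepsilon}{q}$, where $$\varepsilon=\mathcal O\!\left(\sqrt{\tfrac{1}{T_1}m}+\sqrt{\tfrac{1}{T_1}\log(1/p)}\right)\qquad\text{and}\qquad \alpha=\mathcal O\!\left(e^{-T_2}\right).$$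
   Context: **Setting.** $\mathcal T$ is a finite set of test cases, $\Pi=\{\pi_1,\dots,\pi_n\}$ a finite set of tuning policies, and $A\in\mathbb R^{|\mathcal T|\times n}$ a fixed result matrix ($A_{i,j}$ is the result of policy $\pi_j$ on test case $i$). $\triangle^d$ denotes the simplex of probability vectors in $\mathbb R^d$. $\Psi$ is a probability distribution on $\Pi\times\triangle^{|\mathcal T|}$ (pairs of a policy and a "target distribution" $\sigma$). $\mathit\Delta:\mathbb R\times\mathbb R\to\mathbb R$ is a convex error function. For $\hat\sigma\in\triangle^{|\mathcal T|}$ the loss is $$\ell(\hat\sigma;\pi_j,\sigma)=\mathit\Delta\Big(\sum_{i\in\mathcal T}\hat\sigma(i)A_{i,j},\ \sum_{i\in\mathcal T}\sigma(i)A_{i,j}\Big).$$ For a group $\tau\in\mathcal T^m$ of $m$ test cases with weights $\hat\sigma_\tau$ on the members of the group only, $\ell(\hat\sigma_\tau;\pi_j,\sigma)$ means the loss of the vector obtained by putting weight $0$ on all other test cases. Losses take values in $[0,\bar L]$, are convex in the weights, and have subgradients in the weights bounded by $\|\cdot\|_\infty\le G$. **$k$-of-$N$ percentile loss.** For a probability measure $\mu$ on $[0,1]$, $$L_{\mu,\Psi}(\hat\sigma_\tau)=\inf_{y}\int_0^1 y(\eta)\,\mu(d\eta),$$ where the infimum is over bounded, $\mu$-integrable $y:[0,1]\to\mathbb R$ with $\mathbb P_{(\pi,\sigma)\sim\Psi}[\ell(\hat\sigma_\tau;\pi,\sigma)\le y(\eta)]\ge 1-\eta$ for all $\eta\in[0,1]$.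 For integers $1\le k\le N$, the $k$-of-$N$ measure $\mu_{k\text{-of-}N}$ has the non-increasing density $\eta\mapsto\frac Nk\sum_{i=0}^{k-1}\binom{N-1}{i}\eta^i(1-\eta)^{N-1-i}$. Equivalently, $L_{\mu_{k\text{-of-}N},\Psi}(\hat\sigma_\tau)$ is the expectation, over $N$ i.i.d. pairs from $\Psi$, of the average of the $k$ largest of the $N$ losses $\ell(\hat\sigma_\tau;\cdot,\cdot)$. **Algorithm RPOSST$_{\mathrm{SEQ}}$.** Inputs $k,N,T_1,m,\Psi,\tau^0,\ell,T_2$, where $\tau^0\subseteq\mathcal T$ is a (possibly empty) initial set of test cases that must be used. Sample $T'\sim\mathrm{Unif}(\{1,\dots,T_1\})$. For each $\tau\in\mathcal T^m$ initialize $r^0_\tau=\mathbf 0\in\mathbb R^{m+|\tau^0|}$ (one coordinate per test case in $\tau$ and in $\tau^0$). For $t=1,\dots,T'$ and each $\tau\in\mathcal T^m$: 1. Set $\hat\sigma^t_\tau=r^{t-1}_\tau/(\mathbf 1^\top r^{t-1}_\tau)$ if $\mathbf 1^\top r^{t-1}_\tau>0$, else let $\hat\sigma^t_\tau$ be uniform; put weight $0$ on the test cases outside $\tau\cup\tau^0$. 2. Draw $N$ i.i.d. pairs from $\Psi$, and keep the $k$ pairs with the largest losses $\ell(\hat\sigma^t_\tau;\cdot,\cdot)$. Let $v^t_\tau$ be minus the average of the subgradients (in the weights, at $\hat\sigma^t_\tau$) of the $k$ corresponding losses. 3. (Regret matching$^+$.) Set $\rho^t_\tau=v^t_\tau-\big((\hat\sigma^t_\tau)^\top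 v^t_\tau\big)\mathbf 1$ and $r^t_\tau=\max\{r^{t-1}_\tau+\rho^t_\tau,0\}$ coordinatewise. Finally, run the Successive Rejects best-arm-identification algorithm with budget $T_2$ on the arms $\tau\in\mathcal T^m$. A pull of arm $\tau$ draws $N$ i.i.d. pairs from $\Psi$ and returns $\frac{1}{2k\bar L}$ times the sum of the $k$ largest losses of $\hat\sigma^{T'}_\tau$ (smaller is better). Let $\tau^*$ be the arm returned, and output $(\tau^*,\hat\sigma^{T'}_{\tau^*})$. The claim writes the output weights and the weights in the objective as elements of $\triangle^m$, i.e. with no separate symbol for coordinates belonging to $\tau^0$ (when $\tau^0=\emptyset$ this is literal). Successive Rejects with $K$ arms and budget $T_2$: let $\overline{\log}(K)=\frac12+\sum_{i=2}^K\frac1i$, $n_0=0$, and $n_j=\big\lceil\frac{1}{\overline{\log}(K)}\frac{T_2-K}{K+1-j}\big\rceil$. In phases $j=1,\dots,K-1$, pull every remaining arm $n_j-n_{j-1}$ times and then discard the remaining arm with the largest empirical mean loss (ties broken arbitrarily). Return the last remaining arm. *)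

theory Defs
  imports "HOL-Probability.Probability" "HOL-Library.Landau_Symbols"
begin

text \<open>
  Vectors indexed by a finite set \<open>I\<close> are functions that are \<open>undefined\<close> outside \<open>I\<close>, as in
  the library's products \<open>Pi\<^sub>M I\<close>; \<open>prob_simplex I\<close> is the set of probability vectors.
\<close>

definition prob_simplex :: "'i set \<Rightarrow> ('i \<Rightarrow> real) set" where
  "prob_simplex I = {w \<in> extensional I. (\<forall>i\<in>I. 0 \<le> w i) \<and> (\<Sum>i\<in>I. w i) = 1}"

definition prob_simplex_space :: "'i set \<Rightarrow> ('i \<Rightarrow> real) measure" where
  "prob_simplex_space I = restrict_space (Pi\<^sub>M I (\<lambda>_. borel)) (prob_simplex I)"

definition is_subgradient ::
    "'i set \<Rightarrow> (('i \<Rightarrow> real) \<Rightarrow> real) \<Rightarrow> ('i \<Rightarrow> real) \<Rightarrow> ('i \<Rightarrow> real) \<Rightarrow> bool" where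
  "is_subgradient I f w g \<longleftrightarrow> (\<forall>w'. f w + (\<Sum>i\<in>I. g i * (w' i - w i)) \<le> f w')"

record ('t, 'p) problem =
  tests :: "'t set"
  policies :: "'p set"
  result :: "'t \<Rightarrow> 'p \<Rightarrow> real"
  err :: "real \<times> real \<Rightarrow> real"
  Psi :: "('p \<times> ('t \<Rightarrow> real)) measure"

definition valid_problem :: "('t, 'p) problem \<Rightarrow> bool" where
  "valid_problem Q \<longleftrightarrow>
     finite (tests Q) \<and> finite (policies Q) \<and> convex_on UNIV (err Q) \<and>
     prob_space (Psi Q) \<and>
     sets (Psi Q) = sets (count_space (policies Q) \<Otimes>\<^sub>M prob_simplex_space (tests Q))"

definition loss :: "('t, 'p) problem \<Rightarrow> ('t \<Rightarrow> real) \<Rightarrow> 'p \<times> ('t \<Rightarrow> real) \<Rightarrow> real" where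
  "loss Q s = (\<lambda>(\<pi>, \<sigma>).
     err Q (\<Sum>i\<in>tests Q. s i * result Q i \<pi>, \<Sum>i\<in>tests Q. \<sigma> i * result Q i \<pi>))"

definition losses_bounded :: "('t, 'p) problem \<Rightarrow> real \<Rightarrow> bool" where
  "losses_bounded Q Lbar \<longleftrightarrow>
     (\<forall>s\<in>prob_simplex (tests Q). \<forall>z\<in>policies Q \<times> prob_simplex (tests Q). loss Q s z \<in> {0..Lbar})"

definition groups :: "('t, 'p) problem \<Rightarrow> nat \<Rightarrow> 't list set" where
  "groups Q m = {\<tau>. set \<tau> \<subseteq> tests Q \<and> length \<tau> = m}"

text \<open>
  The \<open>m + card \<tau>0\<close> weight coordinates of a group: \<open>Inl i\<close> belongs to the \<open>i\<close>-th entry of the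
  tuple, \<open>Inr x\<close> to the mandatory test case \<open>x\<close>.  A test case that occurs several times
  receives the sum of the weights of its coordinates, and all others receive weight \<open>0\<close>.
\<close>

definition coords :: "nat \<Rightarrow> 't set \<Rightarrow> (nat + 't) set" where
  "coords m \<tau>0 = {..<m} <+> \<tau>0"

definition test_of :: "'t list \<Rightarrow> nat + 't \<Rightarrow> 't" where
  "test_of \<tau> c = (case c of Inl i \<Rightarrow> \<tau> ! i | Inr x \<Rightarrow> x)"

definition extend ::
    "('t, 'p) problem \<Rightarrow> nat \<Rightarrow> 't set \<Rightarrow> 't list \<Rightarrow> (nat + 't \<Rightarrow> real) \<Rightarrow> 't \<Rightarrow> real" where
  "extend Q m \<tau>0 \<tau> w = (\<lambda>x\<in>tests Q. \<Sum>c | c \<in> coords m \<tau>0 \<and> test_of \<tau> c = x. w c)"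

definition group_loss ::
    "('t, 'p) problem \<Rightarrow> nat \<Rightarrow> 't set \<Rightarrow> 't list \<Rightarrow> (nat + 't \<Rightarrow> real) \<Rightarrow>
      'p \<times> ('t \<Rightarrow> real) \<Rightarrow> real" where
  "group_loss Q m \<tau>0 \<tau> w z = loss Q (extend Q m \<tau>0 \<tau> w) z"


definition percentile_loss :: "real measure \<Rightarrow> 'z measure \<Rightarrow> ('z \<Rightarrow> real) \<Rightarrow> real" where
  "percentile_loss \<mu> M f = Inf {(\<integral>\<eta>. y \<eta> \<partial>\<mu>) | y.
     (\<exists>B. \<forall>\<eta>\<in>{0..1}. \<bar>y \<eta>\<bar> \<le> B) \<and> integrable \<mu> y \<and>
     (\<forall>\<eta>\<in>{0..1}. 1 - \<eta> \<le> measure M {z \<in> space M. f z \<le> y \<eta>})}"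

definition k_of_N_measure :: "nat \<Rightarrow> nat \<Rightarrow> real measure" where
  "k_of_N_measure k N = density (restrict_space lborel {0..1})
     (\<lambda>\<eta>. ennreal (real N / real k *
        (\<Sum>i<k. real ((N - 1) choose i) * \<eta> ^ i * (1 - \<eta>) ^ (N - 1 - i))))"

definition k_of_N_loss ::
    "('t, 'p) problem \<Rightarrow> nat \<Rightarrow> nat \<Rightarrow> nat \<Rightarrow> 't set \<Rightarrow> 't list \<Rightarrow> (nat + 't \<Rightarrow> real) \<Rightarrow> real"
  where
  "k_of_N_loss Q k N m \<tau>0 \<tau> w =
     percentile_loss (k_of_N_measure k N) (Psi Q) (group_loss Q m \<tau>0 \<tau> w)"

definition opt_value :: "('t, 'p) problem \<Rightarrow> nat \<Rightarrow> nat \<Rightarrow> nat \<Rightarrow> 't set \<Rightarrow> real" where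
  "opt_value Q k N m \<tau>0 =
     (INF (\<tau>, w) \<in> groups Q m \<times> prob_simplex (coords m \<tau>0). k_of_N_loss Q k N m \<tau>0 \<tau> w)"

definition near_optimal ::
    "('t, 'p) problem \<Rightarrow> nat \<Rightarrow> nat \<Rightarrow> nat \<Rightarrow> 't set \<Rightarrow> real \<Rightarrow>
      't list \<times> (nat + 't \<Rightarrow> real) \<Rightarrow> bool" where
  "near_optimal Q k N m \<tau>0 \<delta> = (\<lambda>(\<tau>, w).
     \<tau> \<in> groups Q m \<and> w \<in> prob_simplex (coords m \<tau>0) \<and>
     k_of_N_loss Q k N m \<tau>0 \<tau> w \<le> opt_value Q k N m \<tau>0 + \<delta>)"


text \<open>
  What the algorithm leaves open: which subgradients are used, and how ties are broken.
  \<open>top_tie t \<tau>\<close> and \<open>arm_tie j\<close> select one of the tied candidates in round \<open>t\<close> for group \<open>\<tau>\<close>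
  and in phase \<open>j\<close> of Successive Rejects, respectively.
\<close>

record ('t, 'p) choices =
  subgrad :: "'t list \<Rightarrow> (nat + 't \<Rightarrow> real) \<Rightarrow> 'p \<times> ('t \<Rightarrow> real) \<Rightarrow> nat + 't \<Rightarrow> real"
  top_tie :: "nat \<Rightarrow> 't list \<Rightarrow> nat set set \<Rightarrow> nat set"
  arm_tie :: "nat \<Rightarrow> 't list set \<Rightarrow> 't list"

definition valid_choices ::
    "('t, 'p) problem \<Rightarrow> nat \<Rightarrow> 't set \<Rightarrow> real \<Rightarrow> ('t, 'p) choices \<Rightarrow> bool" where
  "valid_choices Q m \<tau>0 G Ch \<longleftrightarrow>
     (\<forall>\<tau>\<in>groups Q m. \<forall>w\<in>prob_simplex (coords m \<tau>0). \<forall>z\<in>policies Q \<times> prob_simplex (tests Q).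
        is_subgradient (coords m \<tau>0) (\<lambda>w'. group_loss Q m \<tau>0 \<tau> w' z) w (subgrad Ch \<tau> w z) \<and>
        (\<forall>c\<in>coords m \<tau>0. \<bar>subgrad Ch \<tau> w z c\<bar> \<le> G)) \<and>
     (\<forall>\<tau>\<in>groups Q m. \<forall>c\<in>coords m \<tau>0.
        (\<lambda>(w, z). subgrad Ch \<tau> w z c)
          \<in> borel_measurable (prob_simplex_space (coords m \<tau>0) \<Otimes>\<^sub>M Psi Q)) \<and>
     (\<forall>t \<tau> F. F \<noteq> {} \<longrightarrow> top_tie Ch t \<tau> F \<in> F) \<and>
     (\<forall>j S. S \<noteq> {} \<longrightarrow> arm_tie Ch j S \<in> S)"


definition normalize_weights :: "'i set \<Rightarrow> ('i \<Rightarrow> real) \<Rightarrow> 'i \<Rightarrow> real" where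
  "normalize_weights I r =
     (\<lambda>c\<in>I. if (\<Sum>d\<in>I. r d) > 0 then r c / (\<Sum>d\<in>I. r d) else 1 / real (card I))"

definition rm_plus_step :: "'i set \<Rightarrow> ('i \<Rightarrow> real) \<Rightarrow> ('i \<Rightarrow> real) \<Rightarrow> 'i \<Rightarrow> real" where
  "rm_plus_step I v r =
     (let w = normalize_weights I r
      in (\<lambda>c\<in>I. max (r c + (v c - (\<Sum>d\<in>I. w d * v d))) 0))"

text \<open>The index sets of \<open>k\<close> largest values among \<open>f 0, \<dots>, f (N - 1)\<close>; several only if there are ties.\<close>

definition top_sets :: "nat \<Rightarrow> nat \<Rightarrow> (nat \<Rightarrow> real) \<Rightarrow> nat set set" where
  "top_sets k N f =
     {S. S \<subseteq> {..<N} \<and> card S = k \<and> (\<forall>i\<in>S. \<forall>j\<in>{..<N} - S. f j \<le> f i)}"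

text \<open>
  \<open>X (t, \<tau>, j)\<close> is the \<open>j\<close>-th of the pairs drawn for group \<open>\<tau>\<close> in round \<open>t\<close> (rounds start at 1).
  \<open>regret \<dots> t\<close> is the vector after round \<open>t\<close>; round \<open>t\<close> plays the normalization of \<open>regret \<dots> (t - 1)\<close>.
\<close>

primrec regret ::
    "('t, 'p) problem \<Rightarrow> ('t, 'p) choices \<Rightarrow> nat \<Rightarrow> nat \<Rightarrow> nat \<Rightarrow> 't set \<Rightarrow>
      (nat \<times> 't list \<times> nat \<Rightarrow> 'p \<times> ('t \<Rightarrow> real)) \<Rightarrow> 't list \<Rightarrow> nat \<Rightarrow> nat + 't \<Rightarrow> real" where
  "regret Q Ch k N m \<tau>0 X \<tau> 0 = (\<lambda>c\<in>coords m \<tau>0. 0)"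
| "regret Q Ch k N m \<tau>0 X \<tau> (Suc t) =
     (let r = regret Q Ch k N m \<tau>0 X \<tau> t;
          w = normalize_weights (coords m \<tau>0) r;
          Z = (\<lambda>j. X (Suc t, \<tau>, j));
          S = top_tie Ch (Suc t) \<tau> (top_sets k N (\<lambda>j. group_loss Q m \<tau>0 \<tau> w (Z j)));
          v = (\<lambda>c. - ((\<Sum>j\<in>S. subgrad Ch \<tau> w (Z j) c) / real k))
      in rm_plus_step (coords m \<tau>0) v r)"

definition round_weights ::
    "('t, 'p) problem \<Rightarrow> ('t, 'p) choices \<Rightarrow> nat \<Rightarrow> nat \<Rightarrow> nat \<Rightarrow> 't set \<Rightarrow>
      (nat \<times> 't list \<times> nat \<Rightarrow> 'p \<times> ('t \<Rightarrow> real)) \<Rightarrow> 't list \<Rightarrow> nat \<Rightarrow> nat + 't \<Rightarrow> real" where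
  "round_weights Q Ch k N m \<tau>0 X \<tau> t =
     normalize_weights (coords m \<tau>0) (regret Q Ch k N m \<tau>0 X \<tau> (t - 1))"


definition log_bar :: "nat \<Rightarrow> real" where
  "log_bar K = 1 / 2 + (\<Sum>i=2..K. 1 / real i)"

definition sr_pulls :: "nat \<Rightarrow> nat \<Rightarrow> nat \<Rightarrow> nat" where
  "sr_pulls K T2 j =
     (if j = 0 then 0
      else nat \<lceil>1 / log_bar K * ((real T2 - real K) / (real K + 1 - real j))\<rceil>)"

text \<open>
  \<open>Y a s\<close> is the loss of the \<open>s\<close>-th pull of arm \<open>a\<close>.  An arm still present in phase \<open>j\<close> has been
  pulled \<open>sr_pulls K T2 j\<close> times by the end of it.  \<open>sr_remaining \<dots> j\<close> are the arms left after
  \<open>j\<close> phases.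
\<close>

definition empirical_mean :: "('a \<Rightarrow> nat \<Rightarrow> real) \<Rightarrow> nat \<Rightarrow> 'a \<Rightarrow> real" where
  "empirical_mean Y n a = (\<Sum>s<n. Y a s) / real n"

primrec sr_remaining ::
    "(nat \<Rightarrow> 'a set \<Rightarrow> 'a) \<Rightarrow> 'a set \<Rightarrow> nat \<Rightarrow> ('a \<Rightarrow> nat \<Rightarrow> real) \<Rightarrow> nat \<Rightarrow> 'a set" where
  "sr_remaining tie As T2 Y 0 = As"
| "sr_remaining tie As T2 Y (Suc j) =
     (let R = sr_remaining tie As T2 Y j;
          e = empirical_mean Y (sr_pulls (card As) T2 (Suc j))
      in R - {tie (Suc j) {a \<in> R. \<forall>b\<in>R. e b \<le> e a}})"

definition successive_rejects ::
    "(nat \<Rightarrow> 'a set \<Rightarrow> 'a) \<Rightarrow> 'a set \<Rightarrow> nat \<Rightarrow> ('a \<Rightarrow> nat \<Rightarrow> real) \<Rightarrow> 'a" where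
  "successive_rejects tie As T2 Y = the_elem (sr_remaining tie As T2 Y (card As - 1))"

definition top_sum :: "nat \<Rightarrow> real list \<Rightarrow> real" where
  "top_sum k xs = sum_list (take k (rev (sort xs)))"


text \<open>
  All randomness of a run: the number of rounds \<open>T'\<close>, the i.i.d. pairs \<open>X (t, \<tau>, j)\<close> of the
  optimization game, and the i.i.d. pairs \<open>U (s, \<tau>, j)\<close> of the \<open>s\<close>-th pull of arm \<open>\<tau>\<close>.
  Given these, the run is deterministic.
\<close>

definition rposst_space ::
    "('t, 'p) problem \<Rightarrow> nat \<Rightarrow>
      (nat \<times> (nat \<times> 't list \<times> nat \<Rightarrow> 'p \<times> ('t \<Rightarrow> real))
           \<times> (nat \<times> 't list \<times> nat \<Rightarrow> 'p \<times> ('t \<Rightarrow> real))) measure" where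
  "rposst_space Q T1 =
     uniform_count_measure {1..T1} \<Otimes>\<^sub>M
       (Pi\<^sub>M UNIV (\<lambda>_. Psi Q) \<Otimes>\<^sub>M Pi\<^sub>M UNIV (\<lambda>_. Psi Q))"

definition rposst_seq ::
    "('t, 'p) problem \<Rightarrow> ('t, 'p) choices \<Rightarrow> real \<Rightarrow> nat \<Rightarrow> nat \<Rightarrow> nat \<Rightarrow> 't set \<Rightarrow> nat \<Rightarrow>
      nat \<times> (nat \<times> 't list \<times> nat \<Rightarrow> 'p \<times> ('t \<Rightarrow> real))
          \<times> (nat \<times> 't list \<times> nat \<Rightarrow> 'p \<times> ('t \<Rightarrow> real)) \<Rightarrow>
      't list \<times> (nat + 't \<Rightarrow> real)" where
  "rposst_seq Q Ch Lbar k N m \<tau>0 T2 = (\<lambda>(T', X, U).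
     let w = (\<lambda>\<tau>. round_weights Q Ch k N m \<tau>0 X \<tau> T');
         Y = (\<lambda>\<tau> s. 1 / (2 * real k * Lbar) *
                top_sum k (map (\<lambda>j. group_loss Q m \<tau>0 \<tau> (w \<tau>) (U (s, \<tau>, j))) [0..<N]));
         \<tau>s = successive_rejects (arm_tie Ch) (groups Q m) T2 Y
     in (\<tau>s, w \<tau>s))"

end

theory Submission
  imports Defs "HOL-Combinatorics.List_Permutation"
begin

text \<open>
  The \<open>k\<close>-of-\<open>N\<close> percentile loss equals the expected average of the \<open>k\<close> largest of \<open>N\<close> i.i.d. losses,
  so the losses sampled in a round are unbiased estimates of it, and the round's weights are
  independent of that round's sample.  Regret matching\<open>\<^sup>+\<close> bounds the regret on the sampled losses
  surely; taking expectations, the weights of a random round have expected excess loss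
  \<open>O (sqrt (m / T1))\<close>, and Markov's inequality at level \<open>q / 2\<close> applies.  By Hoeffding's inequality Successive Rejects loses
  only an arbitrarily small amount with probability tending to \<open>1\<close>, uniformly in the weights.  The
  other half of \<open>q\<close> absorbs its failures from some \<open>T2\<close> on, and \<open>\<alpha>\<close> only has to cover smaller \<open>T2\<close>.
\<close>


subsection \<open>Sums of the largest values\<close>

text \<open>The classical guarantee for Successive Rejects bounds the chance of missing the best arm
  in terms of the gaps between arms. Here the arms are groups with random weights, so the gaps may
  vanish; asking only for a nearly best arm makes the bound uniform in the weights. Its failure
  bound decays like \<open>exp (- c * T2)\<close> with a rate \<open>c\<close> that depends on the
  instance and on \<open>T1\<close>, so it need not be \<open>O(exp (- T2))\<close>. This is why
  failures are charged to \<open>q\<close> rather than to \<open>\<alpha>\<close>; the threshold on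
  \<open>T2\<close> may then depend on the instance and on \<open>T1\<close>, but not on
  \<open>p\<close> or \<open>q\<close>. The regret argument concerns a single group, fixed before
  the run together with a comparator of nearly optimal risk; Successive Rejects transfers its
  guarantee to the selected group. The constant therefore does not grow with the number of
  groups.\<close>

lemma top_sets_sum_le:
  assumes S: "S \<in> top_sets k N f" and S': "S' \<subseteq> {..<N}" "card S' = k"
  shows "sum f S' \<le> sum f S"
proof (cases "k = 0")
  case True
  with S S' have "S = {}" "S' = {}"
    by (auto simp: top_sets_def dest: finite_subset)
  then show ?thesis by simp
next
  case False
  have fin: "finite S" "finite S'" "S \<subseteq> {..<N}" "card S = k"
    using S S' by (auto simp: top_sets_def dest: finite_subset)
  \<comment> \<open>\<open>c\<close> is a threshold: values in \<open>S\<close> are at least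
    \<open>c\<close>, values outside at most \<open>c\<close>. As both sets have \<open>k\<close>
    elements, subtracting \<open>c\<close> throughout does not affect the comparison.\<close>
  define c where "c = Min (f ` S)"
  have "f ` S \<noteq> {}" using fin False by auto
  then have c1: "\<And>i. i \<in> S \<Longrightarrow> c \<le> f i" and c2: "c \<in> f ` S"
    using fin Min_in[of "f ` S"] by (auto simp: c_def)
  have c3: "f j \<le> c" if "j \<in> S'" "j \<notin> S" for j
  proof -
    obtain i where "i \<in> S" "c = f i" using c2 by auto
    then show ?thesis using S that S' by (auto simp: top_sets_def)
  qed
  have "(\<Sum>i\<in>S'. f i - c) = (\<Sum>i\<in>S' \<inter> S. f i - c) + (\<Sum>i\<in>S' - S. f i - c)"
    using fin by (metis sum.Int_Diff)
  also have "\<dots> \<le> (\<Sum>i\<in>S' \<inter> S. f i - c) + 0"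
    using c3 by (intro add_left_mono sum_nonpos) auto
  also have "\<dots> \<le> (\<Sum>i\<in>S. f i - c)"
    using fin c1 by (auto intro!: sum_mono2)
  finally show ?thesis using fin S' by (simp add: sum_subtractf)
qed

text \<open>The game works with index sets and the pulls with a sorted list. A permutation that
  sorts the values in decreasing order links them: the images of the first \<open>k\<close>
  positions form a top set.\<close>

lemma sorted_top_set:
  assumes "k \<le> N"
  shows "\<exists>S\<in>top_sets k N f. sum f S = top_sum k (map f [0..<N])"
proof -
  let ?xs = "map f [0..<N]"
  let ?ys = "rev (sort ?xs)"
  have "mset ?ys = mset ?xs" by simp
  from permutation_Ex_bij[OF this] obtain \<sigma> where
    bij: "bij_betw \<sigma> {..<N} {..<N}" and \<sigma>: "\<forall>i<N. ?ys ! i = ?xs ! (\<sigma> i)"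
    by auto
  have ys: "?ys ! i = f (\<sigma> i)" if "i < N" for i
    using that \<sigma> bij_betwE[OF bij] by auto
  have inj: "inj_on \<sigma> {..<k}" and im: "\<sigma> ` {..<k} \<subseteq> {..<N}"
    using assms bij bij_betwE[OF bij] by (auto simp: bij_betw_def inj_on_def)
  have mono: "?ys ! j \<le> ?ys ! i" if "i \<le> j" "j < N" for i j
    using that by (auto simp: rev_nth intro!: sorted_nth_mono)
  have "f j \<le> f i" if ij: "i \<in> \<sigma> ` {..<k}" "j \<in> {..<N} - \<sigma> ` {..<k}" for i j
  proof -
    obtain a where a: "a < k" "i = \<sigma> a" using ij by blast
    obtain b where b: "b < N" "j = \<sigma> b"
      using ij bij by (metis DiffD1 bij_betw_imp_surj_on imageE lessThan_iff)
    have "\<not> b < k" using b ij by auto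
    with a b have "a < k" "i = \<sigma> a" "b < N" "j = \<sigma> b" "\<not> b < k" by auto
    then show ?thesis using mono[of a b] ys assms by auto
  qed
  then have "\<sigma> ` {..<k} \<in> top_sets k N f"
    using inj im by (auto simp: top_sets_def card_image)
  moreover have "sum f (\<sigma> ` {..<k}) = (\<Sum>i<k. ?ys ! i)"
    using inj assms ys by (simp add: sum.reindex)
  moreover have "\<dots> = sum_list (take k ?ys)"
    using assms by (simp add: sum_list_sum_nth atLeast0LessThan)
  ultimately show ?thesis by (auto simp: top_sum_def)
qed

lemma top_sets_nonempty: "k \<le> N \<Longrightarrow> top_sets k N f \<noteq> {}"
  using sorted_top_set by blast

lemma top_sum_eq_sum_top_set:
  assumes "S \<in> top_sets k N f" "k \<le> N"
  shows "top_sum k (map f [0..<N]) = sum f S"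
proof -
  obtain S' where S': "S' \<in> top_sets k N f" "sum f S' = top_sum k (map f [0..<N])"
    using sorted_top_set[OF assms(2)] by blast
  moreover have "sum f S' = sum f S"
    using assms(1) S'(1)
    by (intro antisym top_sets_sum_le[of S k N f S'] top_sets_sum_le[of S' k N f S])
      (auto simp: top_sets_def)
  ultimately show ?thesis by simp
qed

lemma sum_le_top_sum:
  assumes "S \<subseteq> {..<N}" "card S = k" "k \<le> N"
  shows "sum f S \<le> top_sum k (map f [0..<N])"
  using sorted_top_set[OF assms(3), of f] top_sets_sum_le[OF _ assms(1,2)] by metis

lemma top_sum_cong:
  "(\<And>j. j < N \<Longrightarrow> f j = g j) \<Longrightarrow> top_sum k (map f [0..<N]) = top_sum k (map g [0..<N])"
  by (rule arg_cong[of _ _ "top_sum k"]) auto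

lemma top_sum_bounds:
  assumes "k \<le> N" and f: "\<And>j. j < N \<Longrightarrow> f j \<in> {0..L}"
  shows "top_sum k (map f [0..<N]) \<in> {0..real k * L}"
proof -
  obtain S where S: "S \<in> top_sets k N f" using top_sets_nonempty[OF assms(1)] by blast
  then have *: "S \<subseteq> {..<N}" "card S = k" by (auto simp: top_sets_def)
  then have "0 \<le> sum f S" using f by (intro sum_nonneg) auto
  moreover have "sum f S \<le> real (card S) * L" using f * by (intro sum_bounded_above) auto
  ultimately show ?thesis using top_sum_eq_sum_top_set[OF S assms(1)] * by simp
qed

text \<open>If some index above level \<open>x\<close> is left out of \<open>S\<close>, every member
  of \<open>S\<close> is at least as large and also above \<open>x\<close>, so the count is
  \<open>k\<close>; otherwise \<open>S\<close> contains all such indices.\<close>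

lemma card_top_set_Int:
  assumes "S \<in> top_sets k N f"
  shows "card {j\<in>S. x < f j} = min k (card {j\<in>{..<N}. x < f j})"
proof -
  have S: "S \<subseteq> {..<N}" "card S = k" "\<And>i j. i \<in> S \<Longrightarrow> j < N \<Longrightarrow> j \<notin> S \<Longrightarrow> f j \<le> f i"
    using assms by (auto simp: top_sets_def)
  have fin: "finite S" using S(1) finite_subset by blast
  show ?thesis
  proof (cases "\<exists>j<N. j \<notin> S \<and> x < f j")
    case True
    then have eq: "{j\<in>S. x < f j} = S" using S(3) by fastforce
    have "card S \<le> card {j\<in>{..<N}. x < f j}"
      using eq S(1) by (intro card_mono) auto
    then show ?thesis using eq S(2) by simp
  next
    case False
    then have "{j\<in>S. x < f j} = {j\<in>{..<N}. x < f j}" using S(1) by auto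
    moreover have "card {j\<in>S. x < f j} \<le> k" using fin S(2) by (auto intro: card_mono)
    ultimately show ?thesis by simp
  qed
qed

text \<open>The space of levels \<open>x\<close> in the layer cake formula
  \<open>v = \<integral> [x < v] dx\<close>; with \<open>L = 1\<close> also the base of the
  \<open>k\<close>-of-\<open>N\<close> measure.\<close>

definition layers :: "real \<Rightarrow> real measure" where
  "layers L = restrict_space lborel {0..L}"

lemma sets_layers [measurable_cong]: "sets (layers L) = sets (restrict_space borel {0..L})"
  by (simp add: layers_def sets_restrict_space)

lemma space_layers: "space (layers L) = {0..L}"
  by (simp add: layers_def space_restrict_space)

lemma measurable_layers_ident [measurable]: "(\<lambda>x. x) \<in> layers L \<rightarrow>\<^sub>M borel"
  unfolding layers_def by (intro measurable_restrict_space1) simp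

lemma finite_measure_layers: "finite_measure (layers L)"
  by (intro finite_measureI) (simp add: space_layers layers_def emeasure_restrict_space emeasure_lborel_Icc_eq)

lemma integral_layers:
  assumes "v \<in> {0..L}"
  shows "(\<integral>x. of_bool (x < v) \<partial>layers L) = v"
proof -
  have "(\<integral>x. of_bool (x < v) \<partial>layers L) = (\<integral>x. indicator {0..L} x *\<^sub>R (of_bool (x < v) :: real) \<partial>lborel)"
    unfolding layers_def by (rule Bochner_Integration.integral_restrict_space) simp
  also have "\<dots> = (\<integral>x. indicator {0..<v} x \<partial>lborel)"
    using assms by (intro Bochner_Integration.integral_cong) (auto simp: indicator_def)
  also have "\<dots> = v" using assms by simp
  finally show ?thesis .
qed

text \<open>Sums the layer cake formula over a top set. The integrand depends on the sample only
  through the number of values above \<open>x\<close>, which is binomial for i.i.d. samples.\<close>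

lemma top_sum_layers:
  assumes "k \<le> N" and f: "\<And>j. j < N \<Longrightarrow> f j \<in> {0..L}"
  shows "top_sum k (map f [0..<N]) =
    (\<integral>x. real (min k (card {j\<in>{..<N}. x < f j})) \<partial>layers L)"
proof -
  interpret finite_measure "layers L" by (rule finite_measure_layers)
  obtain S where S: "S \<in> top_sets k N f" using top_sets_nonempty[OF assms(1)] by blast
  then have *: "S \<subseteq> {..<N}" "finite S" by (auto simp: top_sets_def dest: finite_subset)
  have "(\<integral>x. real (min k (card {j\<in>{..<N}. x < f j})) \<partial>layers L) =
    (\<integral>x. (\<Sum>j\<in>S. of_bool (x < f j)) \<partial>layers L)"
    using * by (simp only: card_top_set_Int[OF S, symmetric]) (simp add: Int_def)
  also have "\<dots> = (\<Sum>j\<in>S. (\<integral>x. of_bool (x < f j) \<partial>layers L))"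
    by (intro Bochner_Integration.integral_sum integrable_const_bound[where B=1]) auto
  also have "\<dots> = sum f S"
    using f * by (intro sum.cong integral_layers) auto
  finally show ?thesis using top_sum_eq_sum_top_set[OF S assms(1)] by simp
qed

subsection \<open>The percentile loss as an expected sum of order statistics\<close>

text \<open>The expectation of \<open>g X\<close> for \<open>X\<close> binomial with parameters
  \<open>n\<close> and \<open>p\<close>, computed by conditioning on one trial. As a function of
  \<open>p\<close> it is the Bernstein polynomial with coefficients \<open>g\<close>; the recursion
  suits both differentiation and induction over product measures.\<close>

primrec binomial_mean :: "nat \<Rightarrow> (nat \<Rightarrow> real) \<Rightarrow> real \<Rightarrow> real" where
  "binomial_mean 0 g p = g 0"
| "binomial_mean (Suc n) g p =
     p * binomial_mean n (\<lambda>i. g (Suc i)) p + (1 - p) * binomial_mean n g p"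

lemma binomial_mean_diff:
  "binomial_mean n (\<lambda>i. g i - h i) p = binomial_mean n g p - binomial_mean n h p"
proof (induction n arbitrary: g h)
  case (Suc n)
  show ?case unfolding binomial_mean.simps Suc by (simp add: algebra_simps)
qed simp

lemma binomial_mean_0: "binomial_mean n g 0 = g 0"
  by (induction n arbitrary: g) auto

text \<open>The derivative rule of Bernstein polynomials: the degree drops by one and the
  coefficients become forward differences. It is the product rule applied to the recursion.\<close>

lemma has_real_derivative_binomial_mean:
  "(binomial_mean n g has_real_derivative
     real n * binomial_mean (n - 1) (\<lambda>i. g (Suc i) - g i) p) (at p)"
proof (induction n arbitrary: g)
  case 0
  then show ?case by simp
next
  case (Suc n)
  let ?d = "\<lambda>i. g (Suc i) - g i"
  let ?s = "\<lambda>i. g (Suc (Suc i)) - g (Suc i)"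
  have "real n * binomial_mean n ?d p =
    p * (real n * binomial_mean (n - 1) ?s p) + (1 - p) * (real n * binomial_mean (n - 1) ?d p)"
    by (cases n) (simp_all add: algebra_simps)
  \<comment> \<open>The factors \<open>1\<close> and \<open>0 - 1\<close> are the derivatives of
    \<open>p\<close> and \<open>1 - p\<close>, left unsimplified so that the expression matches the
    product rule literally.\<close>
  then have eq: "real (Suc n) * binomial_mean n ?d p =
    1 * binomial_mean n (\<lambda>i. g (Suc i)) p + real n * binomial_mean (n - 1) ?s p * p +
    ((0 - 1) * binomial_mean n g p + real n * binomial_mean (n - 1) ?d p * (1 - p))"
    by (simp add: binomial_mean_diff algebra_simps)
  show ?case
    unfolding binomial_mean.simps diff_Suc_1 eq
    by (intro DERIV_add DERIV_mult DERIV_diff DERIV_ident DERIV_const Suc.IH)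
qed

lemma binomial_mean_eq_sum:
  "binomial_mean n g p = (\<Sum>i\<le>n. real (n choose i) * p ^ i * (1 - p) ^ (n - i) * g i)"
proof (induction n arbitrary: g)
  case 0
  then show ?case by simp
next
  case (Suc n)
  let ?t = "\<lambda>i. real (n choose i) * p ^ i * (1 - p) ^ (Suc n - i) * g i"
  \<comment> \<open>Extending the sum to \<open>Suc n\<close>, where the binomial coefficient
    vanishes, lets the two sums be added termwise by Pascal's rule.\<close>
  have 1: "(1 - p) * binomial_mean n g p = (\<Sum>i\<le>Suc n. ?t i)"
    unfolding Suc sum_distrib_left sum.atMost_Suc
    by (simp add: binomial_eq_0, intro sum.cong refl) (simp add: Suc_diff_le)
  have 2: "p * binomial_mean n (\<lambda>i. g (Suc i)) p =
    (\<Sum>i\<le>n. real (n choose i) * p ^ Suc i * (1 - p) ^ (n - i) * g (Suc i))"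
    unfolding Suc sum_distrib_left by (intro sum.cong refl) simp
  show ?case
    unfolding binomial_mean.simps 1 2 sum.atMost_Suc_shift sum.distrib[symmetric]
    by (simp add: sum.distrib[symmetric] algebra_simps)
qed

section \<open>Hits among i.i.d. samples\<close>

lemma card_eq_sum_of_bool: "finite I \<Longrightarrow> card {j\<in>I. P j} = (\<Sum>j\<in>I. of_bool (P j))"
  by (simp only: card_eq_sum sum.inter_filter of_bool_def)

text \<open>The last sample is split off: a hit has chance \<open>prob A\<close> and shifts
  \<open>g\<close> by one, which is the recursion of \<open>binomial_mean\<close>; hence the
  induction with \<open>g\<close> arbitrary.\<close>

lemma (in prob_space) expectation_card_iid:
  assumes [measurable]: "A \<in> sets M"
  shows "(\<integral>z. g (card {j\<in>{..<N}. z j \<in> A}) \<partial>(\<Pi>\<^sub>M j\<in>{..<N}. M)) = binomial_mean N g (prob A)"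
proof (induction N arbitrary: g)
  case 0
  then show ?case by (simp add: PiM_empty)
next
  case (Suc N)
  interpret prod: product_prob_space "\<lambda>_. M" "{..<Suc N}" by unfold_locales
  interpret PM: prob_space "\<Pi>\<^sub>M j\<in>I. M" for I by (rule prob_space_PiM) unfold_locales
  have meas: "(\<lambda>z. g (card {j\<in>{..<n}. z j \<in> A})) \<in> borel_measurable (\<Pi>\<^sub>M j\<in>{..<n}. M)" for n :: nat and g :: "nat \<Rightarrow> real"
  proof -
    have "(\<lambda>z. \<Sum>j<n. of_bool (z j \<in> A) :: nat) \<in> (\<Pi>\<^sub>M j\<in>{..<n}. M) \<rightarrow>\<^sub>M count_space UNIV"
      by measurable
    from measurable_compose[OF this, of g borel] show ?thesis
      by (simp only: card_eq_sum_of_bool[OF finite_lessThan]) simp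
  qed
  have int: "integrable (\<Pi>\<^sub>M j\<in>{..<n}. M) (\<lambda>z. g (card {j\<in>{..<n}. z j \<in> A}))" for n :: nat and g :: "nat \<Rightarrow> real"
  proof (rule PM.integrable_const_bound[OF _ meas, where B="\<Sum>i\<le>n. \<bar>g i\<bar>"], rule AE_I2)
    fix z :: "nat \<Rightarrow> 'a"
    have "card {j\<in>{..<n}. z j \<in> A} \<le> card {..<n}" by (intro card_mono) auto
    then show "norm (g (card {j\<in>{..<n}. z j \<in> A})) \<le> (\<Sum>i\<le>n. \<bar>g i\<bar>)"
      by (auto intro!: member_le_sum)
  qed
  have ins: "{..<Suc N} = insert N {..<N}" by auto
  have card_upd: "card {j\<in>{..<Suc N}. (x(N := y)) j \<in> A} =
    of_bool (y \<in> A) + card {j\<in>{..<N}. x j \<in> A}" for x and y :: 'a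
  proof -
    have "{j\<in>{..<Suc N}. (x(N := y)) j \<in> A} =
      (if y \<in> A then insert N {j\<in>{..<N}. x j \<in> A} else {j\<in>{..<N}. x j \<in> A})"
      by (auto simp: less_Suc_eq)
    then show ?thesis by simp
  qed
  have inner: "(\<integral>y. g (of_bool (y \<in> A) + c) \<partial>M) = prob A * g (Suc c) + (1 - prob A) * g c" for c
  proof -
    have "(\<integral>y. g (of_bool (y \<in> A) + c) \<partial>M) = (\<integral>y. (g (Suc c) - g c) * indicator A y + g c \<partial>M)"
      by (intro Bochner_Integration.integral_cong) (auto simp: indicator_def)
    also have "\<dots> = (g (Suc c) - g c) * prob A + g c"
      using integrable_const_bound[where B=1 and f="indicator A :: 'a \<Rightarrow> real"]
      by (subst Bochner_Integration.integral_add) (auto simp: prob_space)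
    finally show ?thesis by (simp add: algebra_simps)
  qed
  have "(\<integral>z. g (card {j\<in>{..<Suc N}. z j \<in> A}) \<partial>(\<Pi>\<^sub>M j\<in>{..<Suc N}. M)) =
    (\<integral>x. (\<integral>y. g (card {j\<in>{..<Suc N}. (x(N := y)) j \<in> A}) \<partial>M) \<partial>(\<Pi>\<^sub>M j\<in>{..<N}. M))"
    using int[of "Suc N" g] unfolding ins by (subst prod.product_integral_insert) auto
  also have "\<dots> = (\<integral>x. prob A * g (Suc (card {j\<in>{..<N}. x j \<in> A})) +
      (1 - prob A) * g (card {j\<in>{..<N}. x j \<in> A}) \<partial>(\<Pi>\<^sub>M j\<in>{..<N}. M))"
    unfolding card_upd inner ..
  also have "\<dots> = binomial_mean (Suc N) g (prob A)"
    using int[of N "\<lambda>i. g (Suc i)"] int[of N g]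
    by (subst Bochner_Integration.integral_add) (simp_all add: Suc.IH[symmetric])
  finally show ?case .
qed

text \<open>\<open>N / k\<close> times the probability that fewer than \<open>k\<close> of
  \<open>N - 1\<close> independent trials with success chance \<open>\<eta>\<close> succeed; the
  density inside \<open>k_of_N_measure\<close>.\<close>

definition k_of_N_density :: "nat \<Rightarrow> nat \<Rightarrow> real \<Rightarrow> real" where
  "k_of_N_density k N \<eta> =
     real N / real k * (\<Sum>i<k. real ((N - 1) choose i) * \<eta> ^ i * (1 - \<eta>) ^ (N - 1 - i))"

text \<open>The forward differences of \<open>min k i\<close> are \<open>1\<close> below
  \<open>k\<close> and \<open>0\<close> from there on, so the derivative rule for binomial means
  yields exactly the cumulative binomial sum in the density.\<close>

lemma has_real_derivative_k_of_N:
  assumes "1 \<le> k" "k \<le> N"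
  shows "((\<lambda>p. binomial_mean N (\<lambda>i. real (min k i)) p / real k)
    has_real_derivative k_of_N_density k N p) (at p)"
proof -
  have eq: "real (min k (Suc i)) - real (min k i) = of_bool (i < k)" for i
    by (auto simp: min_def)
  have "binomial_mean (N - 1) (\<lambda>i. of_bool (i < k)) p =
    (\<Sum>i\<in>{..N - 1} \<inter> {i. i < k}. real ((N - 1) choose i) * p ^ i * (1 - p) ^ (N - 1 - i))"
    unfolding binomial_mean_eq_sum by (simp add: sum.inter_restrict of_bool_def if_distrib cong: if_cong)
  also have "{..N - 1} \<inter> {i. i < k} = {..<k}" using assms by auto
  finally show ?thesis
    using DERIV_cdivide[OF has_real_derivative_binomial_mean[of N "\<lambda>i. real (min k i)" p], of "real k"]
    by (simp add: eq k_of_N_density_def)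
qed

lemma k_of_N_measure_eq:
  "k_of_N_measure k N = density (layers 1) (\<lambda>\<eta>. ennreal (k_of_N_density k N \<eta>))"
  by (simp add: k_of_N_measure_def layers_def k_of_N_density_def)

lemma borel_measurable_k_of_N_density [measurable]: "k_of_N_density k N \<in> borel_measurable borel"
  unfolding k_of_N_density_def by measurable

lemma k_of_N_density_nonneg: "\<eta> \<in> {0..1} \<Longrightarrow> 0 \<le> k_of_N_density k N \<eta>"
  unfolding k_of_N_density_def by (intro mult_nonneg_nonneg sum_nonneg) auto

lemma integrable_k_of_N_density: "integrable (layers 1) (k_of_N_density k N)"
proof -
  interpret finite_measure "layers 1" by (rule finite_measure_layers)
  have "continuous_on {0..1} (k_of_N_density k N)"
    unfolding k_of_N_density_def by (intro continuous_intros)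
  then have "compact (k_of_N_density k N ` {0..1})" by (intro compact_continuous_image) auto
  then obtain B where "\<forall>x\<in>{0..1}. \<bar>k_of_N_density k N x\<bar> \<le> B"
    by (auto dest!: compact_imp_bounded simp: bounded_iff)
  then show ?thesis
    by (intro integrable_const_bound[where B=B] AE_I2) (auto simp: space_layers)
qed

lemma integral_k_of_N_measure:
  fixes g :: "real \<Rightarrow> real"
  assumes "g \<in> borel_measurable (layers 1)"
  shows "integral\<^sup>L (k_of_N_measure k N) g = (\<integral>\<eta>. k_of_N_density k N \<eta> * g \<eta> \<partial>layers 1)"
  unfolding k_of_N_measure_eq
  by (subst integral_density) (auto intro!: AE_I2 assms simp: space_layers k_of_N_density_nonneg)

lemma finite_measure_k_of_N: "finite_measure (k_of_N_measure k N)"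
proof
  have "(\<integral>\<^sup>+\<eta>. ennreal (k_of_N_density k N \<eta>) \<partial>layers 1) =
      ennreal (\<integral>\<eta>. k_of_N_density k N \<eta> \<partial>layers 1)"
    by (intro nn_integral_eq_integral integrable_k_of_N_density AE_I2)
      (auto simp: space_layers k_of_N_density_nonneg)
  then show "emeasure (k_of_N_measure k N) (space (k_of_N_measure k N)) \<noteq> \<infinity>"
    unfolding k_of_N_measure_eq by (subst emeasure_density) (simp_all cong: nn_integral_cong)
qed

lemma sets_k_of_N_measure [measurable_cong]: "sets (k_of_N_measure k N) = sets (layers 1)"
  by (simp add: k_of_N_measure_eq)

lemma space_k_of_N_measure: "space (k_of_N_measure k N) = {0..1}"
  by (simp add: k_of_N_measure_eq space_layers)

lemma AE_layers_neq: "AE x in layers L. x \<noteq> a"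
  unfolding layers_def by (subst AE_restrict_space_iff) (auto intro: AE_mp[OF AE_lborel_singleton[of a]])

text \<open>The density is integrated from \<open>0\<close> to \<open>p\<close> by the fundamental
  theorem of calculus; the antiderivative vanishes at \<open>0\<close>.\<close>

lemma k_of_N_measure_less:
  assumes "1 \<le> k" "k \<le> N" "p \<in> {0..1}"
  shows "(\<integral>\<eta>. of_bool (\<eta> < p) \<partial>k_of_N_measure k N) =
    binomial_mean N (\<lambda>i. real (min k i)) p / real k"
proof -
  let ?D = "k_of_N_density k N"
  have "(\<integral>\<eta>. of_bool (\<eta> < p) \<partial>k_of_N_measure k N) = (\<integral>\<eta>. ?D \<eta> * of_bool (\<eta> < p) \<partial>layers 1)"
    by (subst integral_k_of_N_measure) measurable
  \<comment> \<open>Passing from \<open><\<close> to \<open>\<le>\<close> changes one null point and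
    gives the closed interval of the fundamental theorem.\<close>
  also have "\<dots> = (\<integral>\<eta>. ?D \<eta> * indicator {..p} \<eta> \<partial>layers 1)"
    by (intro integral_cong_AE eventually_mono[OF AE_layers_neq[of p]]) (auto simp: indicator_def)
  also have "\<dots> = (\<integral>\<eta>. indicator {0..1} \<eta> *\<^sub>R (?D \<eta> * indicator {..p} \<eta>) \<partial>lborel)"
    unfolding layers_def by (rule Bochner_Integration.integral_restrict_space) simp
  also have "\<dots> = (\<integral>\<eta>. ?D \<eta> * indicator {0..p} \<eta> \<partial>lborel)"
    using assms by (intro Bochner_Integration.integral_cong) (auto simp: indicator_def)
  also have "\<dots> = binomial_mean N (\<lambda>i. real (min k i)) p / real k -
      binomial_mean N (\<lambda>i. real (min k i)) 0 / real k"
  proof (rule integral_FTC_Icc_real)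
    show "isCont ?D x" for x
      unfolding k_of_N_density_def by (intro continuous_intros)
  qed (use assms has_real_derivative_k_of_N in auto)
  finally show ?thesis by (simp add: binomial_mean_0)
qed

text \<open>
  The cheapest feasible \<open>y\<close> is the quantile function \<open>y \<eta> = \<integral> [\<eta> < P (x < f)] dx\<close>.  Exchanging the
  integrals turns its \<open>k\<close>-of-\<open>N\<close> mean into the layer cake formula of the \<open>k\<close> largest of \<open>N\<close> losses.
\<close>

lemma (in prob_space) percentile_loss_k_of_N:
  assumes [measurable]: "f \<in> borel_measurable M"
    and f: "\<And>z. z \<in> space M \<Longrightarrow> f z \<in> {0..L}" and kN: "1 \<le> k" "k \<le> N"
  shows "percentile_loss (k_of_N_measure k N) M f =
    (\<integral>z. top_sum k (map (\<lambda>j. f (z j)) [0..<N]) \<partial>(\<Pi>\<^sub>M j\<in>{..<N}. M)) / real k"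
proof -
  let ?\<mu> = "k_of_N_measure k N" and ?P = "\<Pi>\<^sub>M j\<in>{..<N}. M"
  \<comment> \<open>Survival function of the loss. In its terms the probability constraint on
    \<open>y\<close> reads \<open>S (y \<eta>) \<le> \<eta>\<close>; this is
    \<open>le_iff\<close>.\<close>
  define S where "S x = prob {z\<in>space M. x < f z}" for x
  have S01: "S x \<in> {0..1}" for x by (simp add: S_def)
  have S_mono: "S x' \<le> S x" if "x \<le> x'" for x x'
    unfolding S_def using that by (intro finite_measure_mono) auto
  have "mono (\<lambda>x. - S x)" using S_mono by (auto simp: mono_def)
  then have "(\<lambda>x. - (- S x)) \<in> borel_measurable borel"
    by (intro borel_measurable_uminus borel_measurable_mono)
  then have S_meas [measurable]: "S \<in> borel_measurable borel" by simp
  have le_iff: "1 - \<eta> \<le> prob {z\<in>space M. f z \<le> v} \<longleftrightarrow> S v \<le> \<eta>" for v \<eta>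
  proof -
    have "{z\<in>space M. f z \<le> v} = space M - {z\<in>space M. v < f z}" by auto
    then have "prob {z\<in>space M. f z \<le> v} = 1 - S v"
      unfolding S_def by (simp add: prob_compl)
    then show ?thesis by auto
  qed
  obtain z0 where z0: "z0 \<in> space M" using not_empty by auto
  have "0 \<le> L" using f[OF z0] by auto

  interpret lay: finite_measure "layers L" by (rule finite_measure_layers)
  interpret \<mu>: finite_measure ?\<mu> by (rule finite_measure_k_of_N)
  interpret PP: prob_space ?P by (rule prob_space_PiM) unfold_locales
  interpret \<mu>lay: pair_sigma_finite ?\<mu> "layers L" by unfold_locales
  interpret Play: pair_sigma_finite ?P "layers L" by unfold_locales
  interpret \<mu>lay': finite_measure "?\<mu> \<Otimes>\<^sub>M layers L"
    by (rule finite_measure_pair_measure) unfold_locales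
  interpret Play': finite_measure "?P \<Otimes>\<^sub>M layers L"
    by (rule finite_measure_pair_measure) unfold_locales

  define q :: "real \<Rightarrow> real" where "q \<eta> = (\<integral>x. of_bool (\<eta> < S x) \<partial>layers L)" for \<eta>
  have q_ge: "v \<le> q \<eta>" if "v \<in> {0..L}" "\<And>x. x < v \<Longrightarrow> \<eta> < S x" for v \<eta>
  proof -
    have "v = (\<integral>x. of_bool (x < v) \<partial>layers L)" using integral_layers[OF that(1)] by simp
    also have "\<dots> \<le> q \<eta>"
      unfolding q_def by (intro integral_mono lay.integrable_const_bound[where B=1]) (auto simp: that(2))
    finally show ?thesis .
  qed
  have q_le: "q \<eta> \<le> v" if "v \<in> {0..L}" "\<And>x. \<eta> < S x \<Longrightarrow> x < v" for v \<eta>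
  proof -
    have "q \<eta> \<le> (\<integral>x. of_bool (x < v) \<partial>layers L)"
      unfolding q_def by (intro integral_mono lay.integrable_const_bound[where B=1]) (auto simp: that(2))
    also have "\<dots> = v" using integral_layers[OF that(1)] by simp
    finally show ?thesis .
  qed
  have q_bound: "q \<eta> \<in> {0..L}" for \<eta>
  proof -
    have "0 \<le> q \<eta>" unfolding q_def by (intro Bochner_Integration.integral_nonneg) auto
    moreover have "q \<eta> \<le> (\<integral>x. 1 \<partial>layers L)"
      unfolding q_def by (intro integral_mono lay.integrable_const_bound[where B=1]) auto
    moreover have "(\<integral>x. 1 \<partial>layers L) = L"
      using \<open>0 \<le> L\<close> by (simp add: measure_restrict_space layers_def space_restrict_space)
    ultimately show ?thesis by simp
  qed
  have q_feasible: "S (q \<eta>) \<le> \<eta>" if "\<eta> \<in> {0..1}" for \<eta>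
  proof -
    \<comment> \<open>Above \<open>q \<eta>\<close> the bound holds by monotonicity: were
      \<open>\<eta> < S x\<close>, all levels up to \<open>x\<close> would count towards
      \<open>q \<eta>\<close>. At \<open>q \<eta>\<close> itself it follows from right-continuity of
      \<open>S\<close>, as a limit along \<open>1 / (n + 1)\<close>.\<close>
    have "S x \<le> \<eta>" if "q \<eta> < x" for x
    proof (rule ccontr)
      assume "\<not> S x \<le> \<eta>"
      then have *: "\<eta> < S x'" if "x' \<le> x" for x' using S_mono[OF that] by simp
      have "x \<le> L"
      proof (rule ccontr)
        assume "\<not> x \<le> L"
        then have "{z\<in>space M. x < f z} = {}" using f by fastforce
        then have "S x = 0" unfolding S_def by (simp only: measure_empty)
        then show False using *[of x] \<open>\<eta> \<in> {0..1}\<close> by simp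
      qed
      then have "x \<le> q \<eta>" using q_bound[of \<eta>] \<open>q \<eta> < x\<close> * by (intro q_ge) auto
      then show False using \<open>q \<eta> < x\<close> by simp
    qed
    then have "S (q \<eta> + inverse (real (Suc n))) \<le> \<eta>" for n by simp
    moreover have "(\<lambda>n. S (q \<eta> + inverse (real (Suc n)))) \<longlonglongrightarrow>
      prob (\<Union>n. {z\<in>space M. q \<eta> + inverse (real (Suc n)) < f z})"
      unfolding S_def
    proof (rule finite_Lim_measure_incseq)
      show "incseq (\<lambda>n. {z\<in>space M. q \<eta> + inverse (real (Suc n)) < f z})"
      proof (rule incseq_SucI, safe)
        fix n z assume "q \<eta> + inverse (real (Suc n)) < f z"
        moreover have "inverse (real (Suc (Suc n))) \<le> inverse (real (Suc n))"
          by (intro le_imp_inverse_le) auto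
        ultimately show "q \<eta> + inverse (real (Suc (Suc n))) < f z" by linarith
      qed
    qed auto
    moreover have "(\<Union>n. {z\<in>space M. q \<eta> + inverse (real (Suc n)) < f z}) = {z\<in>space M. q \<eta> < f z}"
    proof safe
      fix n z assume "q \<eta> + inverse (real (Suc n)) < f z"
      moreover have "0 < inverse (real (Suc n))" by simp
      ultimately show "q \<eta> < f z" by linarith
    next
      fix z assume "z \<in> space M" "q \<eta> < f z"
      then obtain n where "inverse (real (Suc n)) < f z - q \<eta>"
        using reals_Archimedean[of "f z - q \<eta>"] by auto
      then show "z \<in> (\<Union>n. {z\<in>space M. q \<eta> + inverse (real (Suc n)) < f z})"
        using \<open>z \<in> space M\<close> by (auto intro!: exI[of _ n])
    qed
    ultimately show ?thesis
      unfolding S_def by (intro LIMSEQ_le_const2) auto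
  qed
  have q_meas [measurable]: "q \<in> borel_measurable (layers 1)"
    unfolding q_def by measurable
  have q_int: "integrable ?\<mu> q"
    using q_bound by (intro \<mu>.integrable_const_bound[where B=L]) (auto intro!: AE_I2)

  have "percentile_loss ?\<mu> M f = integral\<^sup>L ?\<mu> q"
    unfolding percentile_loss_def
  proof (rule cInf_eq_minimum)
    show "integral\<^sup>L ?\<mu> q \<in> {(\<integral>\<eta>. y \<eta> \<partial>?\<mu>) | y. (\<exists>B. \<forall>\<eta>\<in>{0..1}. \<bar>y \<eta>\<bar> \<le> B) \<and> integrable ?\<mu> y \<and>
      (\<forall>\<eta>\<in>{0..1}. 1 - \<eta> \<le> prob {z\<in>space M. f z \<le> y \<eta>})}"
      using q_bound q_int q_feasible unfolding le_iff
      by (auto intro!: exI[of _ q] exI[of _ L])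
  next
    fix v assume "v \<in> {(\<integral>\<eta>. y \<eta> \<partial>?\<mu>) | y. (\<exists>B. \<forall>\<eta>\<in>{0..1}. \<bar>y \<eta>\<bar> \<le> B) \<and> integrable ?\<mu> y \<and>
      (\<forall>\<eta>\<in>{0..1}. 1 - \<eta> \<le> prob {z\<in>space M. f z \<le> y \<eta>})}"
    then obtain y where y: "v = integral\<^sup>L ?\<mu> y" "integrable ?\<mu> y" "\<And>\<eta>. \<eta> \<in> {0..1} \<Longrightarrow> S (y \<eta>) \<le> \<eta>"
      unfolding le_iff by auto
    \<comment> \<open>At \<open>\<eta> = 1\<close> the constraint is vacuous, so \<open>y 1\<close>
      may lie below \<open>q 1\<close>; this single point is null.\<close>
    have "AE \<eta> in ?\<mu>. \<eta> \<noteq> 1"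
      unfolding k_of_N_measure_eq by (subst AE_density) (auto intro: AE_mp[OF AE_layers_neq[of 1]])
    then have "AE \<eta> in ?\<mu>. q \<eta> \<le> y \<eta>"
    proof (rule AE_mp, intro AE_I2 impI)
      fix \<eta> assume "\<eta> \<in> space ?\<mu>" "\<eta> \<noteq> 1"
      then have \<eta>: "\<eta> \<in> {0..1}" "\<eta> < 1" by (auto simp: space_k_of_N_measure)
      have less: "x < y \<eta>" if "\<eta> < S x" for x
        using S_mono[of "y \<eta>" x] y(3)[OF \<eta>(1)] that by (cases "x < y \<eta>") auto
      have "0 \<le> y \<eta>"
      proof (rule ccontr)
        assume "\<not> 0 \<le> y \<eta>"
        then have "{z\<in>space M. y \<eta> < f z} = space M" using f by fastforce
        then have "S (y \<eta>) = 1" unfolding S_def by (simp only: prob_space)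
        then show False using y(3)[OF \<eta>(1)] \<eta>(2) by simp
      qed
      show "q \<eta> \<le> y \<eta>"
      proof (cases "y \<eta> \<le> L")
        case True
        then show ?thesis using \<open>0 \<le> y \<eta>\<close> less by (intro q_le) auto
      next
        case False
        then show ?thesis using q_bound[of \<eta>] by simp
      qed
    qed
    then show "integral\<^sup>L ?\<mu> q \<le> v"
      unfolding y(1) by (intro integral_mono_AE q_int y(2))
  qed
  also have "\<dots> = (\<integral>x. (\<integral>\<eta>. of_bool (\<eta> < S x) \<partial>?\<mu>) \<partial>layers L)"
    unfolding q_def
    by (subst \<mu>lay.Fubini_integral) (auto intro!: \<mu>lay'.integrable_const_bound[where B=1])
  also have "\<dots> = (\<integral>x. binomial_mean N (\<lambda>i. real (min k i)) (S x) / real k \<partial>layers L)"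
    using k_of_N_measure_less[OF kN S01] by simp
  also have "\<dots> = (\<integral>x. binomial_mean N (\<lambda>i. real (min k i)) (S x) \<partial>layers L) / real k"
    by simp
  \<comment> \<open>For each level \<open>x\<close> the number of losses above \<open>x\<close> is
    binomial with success chance \<open>S x\<close>.\<close>
  also have "(\<integral>x. binomial_mean N (\<lambda>i. real (min k i)) (S x) \<partial>layers L) =
    (\<integral>x. (\<integral>z. real (min k (card {j\<in>{..<N}. x < f (z j)})) \<partial>?P) \<partial>layers L)"
  proof (rule Bochner_Integration.integral_cong[OF refl])
    fix x
    have "(\<integral>z. real (min k (card {j\<in>{..<N}. x < f (z j)})) \<partial>?P) =
      (\<integral>z. real (min k (card {j\<in>{..<N}. z j \<in> {z\<in>space M. x < f z}})) \<partial>?P)"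
      by (intro Bochner_Integration.integral_cong refl arg_cong[of _ _ "\<lambda>A. real (min k (card A))"])
        (auto simp: space_PiM PiE_iff)
    also have "\<dots> = binomial_mean N (\<lambda>i. real (min k i)) (S x)"
      unfolding S_def by (rule expectation_card_iid) measurable
    finally show "binomial_mean N (\<lambda>i. real (min k i)) (S x) =
      (\<integral>z. real (min k (card {j\<in>{..<N}. x < f (z j)})) \<partial>?P)" by simp
  qed
  also have "\<dots> = (\<integral>z. (\<integral>x. real (min k (card {j\<in>{..<N}. x < f (z j)})) \<partial>layers L) \<partial>?P)"
  proof (rule Play.Fubini_integral, rule Play'.integrable_const_bound[where B="real k"])
    have "(\<lambda>w. \<Sum>j<N. of_bool (snd w < f (fst w j)) :: nat) \<in> ?P \<Otimes>\<^sub>M layers L \<rightarrow>\<^sub>M count_space UNIV"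
      by measurable
    from measurable_compose[OF this, of "\<lambda>c. real (min k c)" borel]
    show "(\<lambda>(z, x). real (min k (card {j\<in>{..<N}. x < f (z j)}))) \<in> borel_measurable (?P \<Otimes>\<^sub>M layers L)"
      by (simp only: card_eq_sum_of_bool[OF finite_lessThan] split_beta') simp
  qed auto
  also have "\<dots> = (\<integral>z. top_sum k (map (\<lambda>j. f (z j)) [0..<N]) \<partial>?P)"
    using f by (intro Bochner_Integration.integral_cong refl top_sum_layers[symmetric] kN)
      (auto simp: space_PiM PiE_iff)
  finally show ?thesis .
qed

subsection \<open>Regret matching\<close>

lemma normalize_weights_simplex:
  assumes "finite I" "I \<noteq> {}" "\<And>c. c \<in> I \<Longrightarrow> 0 \<le> r c"
  shows "normalize_weights I r \<in> prob_simplex I"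
proof (cases "(\<Sum>d\<in>I. r d) > 0")
  case True
  then show ?thesis
    using assms by (auto simp: prob_simplex_def normalize_weights_def sum_divide_distrib[symmetric])
next
  case False
  then show ?thesis
    using assms by (auto simp: prob_simplex_def normalize_weights_def)
qed

lemma prob_simplex_inner_abs_le:
  assumes "w \<in> prob_simplex I" "\<forall>c\<in>I. \<bar>v c\<bar> \<le> G"
  shows "\<bar>\<Sum>c\<in>I. w c * v c\<bar> \<le> G"
proof -
  have "\<bar>\<Sum>c\<in>I. w c * v c\<bar> \<le> (\<Sum>c\<in>I. \<bar>w c * v c\<bar>)" by (rule sum_abs)
  also have "\<dots> \<le> (\<Sum>c\<in>I. w c * G)"
    using assms by (intro sum_mono) (auto simp: abs_mult prob_simplex_def intro!: mult_mono)
  also have "\<dots> = G" using assms(1) by (simp add: sum_distrib_right[symmetric] prob_simplex_def)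
  finally show ?thesis .
qed

text \<open>The increment \<open>\<rho>\<close> is orthogonal to \<open>r\<close>: the weights are
  proportional to \<open>r\<close> if it has positive mass, and otherwise \<open>r\<close> is zero.
  So the cross term vanishes, and clipping at \<open>0\<close> only decreases squares.
  \<open>2 * G\<close> bounds \<open>v\<close> minus its weighted average.\<close>

lemma rm_plus_step_sum_squares_le:
  assumes I: "finite I" "I \<noteq> {}" and r: "\<And>c. c \<in> I \<Longrightarrow> 0 \<le> r c"
    and v: "\<forall>c\<in>I. \<bar>v c\<bar> \<le> G"
  shows "(\<Sum>c\<in>I. (rm_plus_step I v r c)\<^sup>2) \<le> (\<Sum>c\<in>I. (r c)\<^sup>2) + real (card I) * (2 * G)\<^sup>2"
proof -
  define w where "w = normalize_weights I r"
  define \<rho> where "\<rho> c = v c - (\<Sum>d\<in>I. w d * v d)" for c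
  have w: "w \<in> prob_simplex I" unfolding w_def using I r by (rule normalize_weights_simplex)
  have \<rho>: "(\<rho> c)\<^sup>2 \<le> (2 * G)\<^sup>2" if "c \<in> I" for c
  proof -
    have "\<bar>\<rho> c\<bar> \<le> 2 * G"
      using bspec[OF v that] prob_simplex_inner_abs_le[OF w v] unfolding \<rho>_def by linarith
    then show ?thesis by (rule abs_le_square_iff[THEN iffD1, OF order_trans]) auto
  qed
  have "(\<Sum>c\<in>I. r c * \<rho> c) = 0"
  proof (cases "(\<Sum>d\<in>I. r d) > 0")
    case True
    have "(\<Sum>d\<in>I. r d) * (\<Sum>d\<in>I. w d * v d) = (\<Sum>d\<in>I. r d * v d)"
      unfolding sum_distrib_left using True
      by (intro sum.cong refl) (auto simp: w_def normalize_weights_def)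
    then show ?thesis
      by (simp add: \<rho>_def right_diff_distrib sum_subtractf sum_distrib_right)
  next
    case False
    then have "(\<Sum>d\<in>I. r d) = 0" using r by (meson linorder_not_less order_antisym sum_nonneg)
    then have "\<forall>d\<in>I. r d = 0" using I r by (simp add: sum_nonneg_eq_0_iff)
    then show ?thesis by simp
  qed
  have "(\<Sum>c\<in>I. (rm_plus_step I v r c)\<^sup>2) \<le> (\<Sum>c\<in>I. (r c + \<rho> c)\<^sup>2)"
    by (intro sum_mono) (auto simp: rm_plus_step_def w_def \<rho>_def Let_def max_def)
  also have "\<dots> = (\<Sum>c\<in>I. (r c)\<^sup>2) + 2 * (\<Sum>c\<in>I. r c * \<rho> c) + (\<Sum>c\<in>I. (\<rho> c)\<^sup>2)"
    by (simp add: power2_sum sum.distrib sum_distrib_left algebra_simps)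
  also have "(\<Sum>c\<in>I. (\<rho> c)\<^sup>2) \<le> (\<Sum>c\<in>I. (2 * G)\<^sup>2)" by (intro sum_mono \<rho>)
  finally show ?thesis using \<open>(\<Sum>c\<in>I. r c * \<rho> c) = 0\<close> by simp
qed

text \<open>Clipping only raises coordinates, so the accumulated \<open>\<rho>\<close> stays below
  \<open>r T\<close>, and the bound on the sum of squares caps each coordinate of
  \<open>r T\<close>. The regret against \<open>u\<close> is the \<open>u\<close>-average of the
  accumulated \<open>\<rho>\<close>.\<close>

lemma rm_plus_regret_le:
  assumes I: "finite I" "I \<noteq> {}"
    and r0: "\<And>c. c \<in> I \<Longrightarrow> r 0 c = 0" and r_Suc: "\<And>t. r (Suc t) = rm_plus_step I (v t) (r t)"
    and v: "\<And>t c. t < T \<Longrightarrow> c \<in> I \<Longrightarrow> \<bar>v t c\<bar> \<le> G" and u: "u \<in> prob_simplex I"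
  shows "(\<Sum>t<T. \<Sum>c\<in>I. (u c - normalize_weights I (r t) c) * v t c) \<le>
    2 * \<bar>G\<bar> * sqrt (real T * real (card I))"
proof -
  define w where "w t = normalize_weights I (r t)" for t
  define \<rho> where "\<rho> t c = v t c - (\<Sum>d\<in>I. w t d * v t d)" for t c
  have r_nonneg: "0 \<le> r t c" if "c \<in> I" for t c
    using that r0 by (cases t) (auto simp: r_Suc rm_plus_step_def Let_def)
  have "n \<le> T \<Longrightarrow> (\<Sum>c\<in>I. (r n c)\<^sup>2) \<le> real n * (real (card I) * (2 * G)\<^sup>2)" for n
  proof (induction n)
    case 0
    then show ?case using r0 by simp
  next
    case (Suc n)
    then show ?case
      using rm_plus_step_sum_squares_le[OF I, of "r n" "v n" G] r_nonneg v[of n]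
      by (simp add: r_Suc algebra_simps)
  qed
  then have sq: "(\<Sum>c\<in>I. (r T c)\<^sup>2) \<le> (2 * \<bar>G\<bar> * sqrt (real T * real (card I)))\<^sup>2"
    by (simp add: power_mult_distrib algebra_simps)
  have rT: "r T c \<le> 2 * \<bar>G\<bar> * sqrt (real T * real (card I))" if "c \<in> I" for c
  proof -
    have "(r T c)\<^sup>2 \<le> (\<Sum>c\<in>I. (r T c)\<^sup>2)"
      using I that by (intro member_le_sum) auto
    from order_trans[OF this sq] show ?thesis by (rule power2_le_imp_le) auto
  qed
  have \<rho>_le: "(\<Sum>t<n. \<rho> t c) \<le> r n c" if "c \<in> I" for n c
  proof (induction n)
    case 0
    then show ?case using r0[OF that] by simp
  next
    case (Suc n)
    then show ?case
      using that by (auto simp: r_Suc rm_plus_step_def Let_def \<rho>_def w_def)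
  qed
  have "(\<Sum>t<T. \<Sum>c\<in>I. (u c - w t c) * v t c) = (\<Sum>t<T. \<Sum>c\<in>I. u c * \<rho> t c)"
  proof (rule sum.cong[OF refl])
    fix t
    have "(\<Sum>c\<in>I. u c * \<rho> t c) = (\<Sum>c\<in>I. u c * v t c) - (\<Sum>c\<in>I. u c) * (\<Sum>d\<in>I. w t d * v t d)"
      by (simp add: \<rho>_def right_diff_distrib sum_subtractf sum_distrib_right)
    then show "(\<Sum>c\<in>I. (u c - w t c) * v t c) = (\<Sum>c\<in>I. u c * \<rho> t c)"
      using u by (simp add: prob_simplex_def left_diff_distrib sum_subtractf)
  qed
  also have "\<dots> = (\<Sum>c\<in>I. u c * (\<Sum>t<T. \<rho> t c))"
    by (subst sum.swap) (simp add: sum_distrib_left)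
  also have "\<dots> \<le> (\<Sum>c\<in>I. u c * (2 * \<bar>G\<bar> * sqrt (real T * real (card I))))"
  proof (intro sum_mono mult_left_mono)
    fix c assume "c \<in> I"
    then show "(\<Sum>t<T. \<rho> t c) \<le> 2 * \<bar>G\<bar> * sqrt (real T * real (card I))" "0 \<le> u c"
      using \<rho>_le[of c T] rT[of c] u by (auto simp: prob_simplex_def)
  qed
  also have "\<dots> = 2 * \<bar>G\<bar> * sqrt (real T * real (card I))"
    using u by (simp add: prob_simplex_def sum_distrib_right[symmetric])
  finally show ?thesis by (simp add: w_def)
qed

subsection \<open>Successive Rejects\<close>

lemma argmax_nonempty:
  fixes e :: "'a \<Rightarrow> real"
  assumes "finite R" "R \<noteq> {}"
  shows "{a \<in> R. \<forall>b\<in>R. e b \<le> e a} \<noteq> {}"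
proof -
  have "Max (e ` R) \<in> e ` R" using assms by (intro Max_in) auto
  then obtain a where "a \<in> R" "e a = Max (e ` R)" by auto
  then have "a \<in> {a \<in> R. \<forall>b\<in>R. e b \<le> e a}" using assms(1) by simp
  then show ?thesis by blast
qed

lemma sr_remaining_props:
  assumes As: "finite As" and tie: "\<forall>j S. S \<noteq> {} \<longrightarrow> tie j S \<in> S" and "j < card As"
  shows "sr_remaining tie As T2 Y j \<subseteq> As \<and> card (sr_remaining tie As T2 Y j) = card As - j"
  using \<open>j < card As\<close>
proof (induction j)
  case (Suc j)
  let ?R = "sr_remaining tie As T2 Y j"
  let ?e = "empirical_mean Y (sr_pulls (card As) T2 (Suc j))"
  let ?worst = "{a \<in> ?R. \<forall>b\<in>?R. ?e b \<le> ?e a}"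
  have R: "?R \<subseteq> As" "card ?R = card As - j" using Suc by simp_all
  have "finite ?R" using R(1) As finite_subset by blast
  have "card ?R \<noteq> 0" using R(2) Suc.prems by simp
  then have "?R \<noteq> {}" by auto
  then have "?worst \<noteq> {}" using \<open>finite ?R\<close> by (intro argmax_nonempty)
  define x where "x = tie (Suc j) ?worst"
  have "x \<in> ?worst" unfolding x_def by (rule tie[rule_format, OF \<open>?worst \<noteq> {}\<close>])
  then have "x \<in> ?R" by simp
  have eq: "sr_remaining tie As T2 Y (Suc j) = ?R - {x}" by (simp add: Let_def x_def)
  show ?case
    unfolding eq using R \<open>x \<in> ?R\<close> by (simp add: card_Diff_singleton subset_insertI2 Diff_subset_conv)
qed simp_all

lemma sr_remaining_final:
  assumes "finite As" "As \<noteq> {}" "\<forall>j S. S \<noteq> {} \<longrightarrow> tie j S \<in> S"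
  shows "sr_remaining tie As T2 Y (card As - 1) = {successive_rejects tie As T2 Y}"
proof -
  have "card As - 1 < card As" using assms by (simp add: card_gt_0_iff)
  then have "card (sr_remaining tie As T2 Y (card As - 1)) = 1"
    using sr_remaining_props[OF assms(1,3), of "card As - 1"] by auto
  then obtain a where "sr_remaining tie As T2 Y (card As - 1) = {a}"
    by (auto simp: card_1_singleton_iff)
  then show ?thesis by (simp add: successive_rejects_def)
qed

lemma successive_rejects_in:
  assumes "finite As" "As \<noteq> {}" "\<forall>j S. S \<noteq> {} \<longrightarrow> tie j S \<in> S"
  shows "successive_rejects tie As T2 Y \<in> As"
proof -
  have "card As - 1 < card As" using assms by (simp add: card_gt_0_iff)
  from sr_remaining_props[OF assms(1,3) this, of T2 Y] show ?thesis
    unfolding sr_remaining_final[OF assms] by simp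
qed

text \<open>A phase in which the best remaining arm is discarded raises the best remaining mean by at most \<open>2 * \<gamma>\<close>.\<close>

lemma successive_rejects_near_best:
  assumes As: "finite As" "As \<noteq> {}" and tie: "\<forall>j S. S \<noteq> {} \<longrightarrow> tie j S \<in> S" and "0 \<le> \<gamma>"
    and close: "\<And>j a. 1 \<le> j \<Longrightarrow> j < card As \<Longrightarrow> a \<in> As \<Longrightarrow>
      \<bar>empirical_mean Y (sr_pulls (card As) T2 j) a - \<mu> a\<bar> \<le> \<gamma>"
    and "b \<in> As"
  shows "\<mu> (successive_rejects tie As T2 Y) \<le> \<mu> b + 2 * \<gamma> * real (card As)"
proof -
  have "j < card As \<Longrightarrow> \<exists>a\<in>sr_remaining tie As T2 Y j. \<mu> a \<le> \<mu> b + 2 * \<gamma> * real j" for j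
  proof (induction j)
    case 0
    then show ?case using \<open>b \<in> As\<close> by auto
  next
    case (Suc j)
    let ?R = "sr_remaining tie As T2 Y j" and ?R' = "sr_remaining tie As T2 Y (Suc j)"
    let ?e = "empirical_mean Y (sr_pulls (card As) T2 (Suc j))"
    let ?worst = "{a \<in> ?R. \<forall>b\<in>?R. ?e b \<le> ?e a}"
    have R: "?R \<subseteq> As" using sr_remaining_props[OF As(1) tie] Suc.prems by simp
    have R': "?R' = ?R - {tie (Suc j) ?worst}" by (simp add: Let_def)
    note sr_remaining.simps [simp del]
    \<comment> \<open>Since \<open>Suc j < card As\<close>, the phase leaves some arm
      \<open>c\<close>. If it discards \<open>a\<close>, the empirical mean of \<open>c\<close> is
      no larger than that of \<open>a\<close>, and two estimation errors of \<open>\<gamma>\<close>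
      bound the increase of the true mean.\<close>
    have "card ?R' \<noteq> 0" using sr_remaining_props[OF As(1) tie Suc.prems, of T2 Y] Suc.prems by simp
    then obtain c where c: "c \<in> ?R'" by fastforce
    obtain a where a: "a \<in> ?R" "\<mu> a \<le> \<mu> b + 2 * \<gamma> * real j" using Suc by auto
    show ?case
    proof (cases "a \<in> ?R'")
      case True
      then show ?thesis using a(2) \<open>0 \<le> \<gamma>\<close> by (intro bexI[of _ a]) (auto simp: algebra_simps)
    next
      case False
      have cR: "c \<in> ?R" using c R' by auto
      have "?worst \<noteq> {}"
        using a(1) R As(1) by (intro argmax_nonempty) (auto dest: finite_subset)
      from tie[rule_format, OF this] have "tie (Suc j) ?worst \<in> ?worst" .
      then have "a \<in> ?worst" using False a(1) unfolding R' by auto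
      then have "?e c \<le> ?e a" using cR by blast
      then have "\<mu> c \<le> \<mu> a + 2 * \<gamma>"
        using close[of "Suc j" a] close[of "Suc j" c] Suc.prems a(1) cR R
        by (simp add: abs_le_iff subset_iff)
      then have "\<mu> c \<le> \<mu> b + 2 * \<gamma> * real (Suc j)" using a(2) by (simp add: algebra_simps)
      then show ?thesis using c by blast
    qed
  qed
  from this[of "card As - 1"] have
    "\<mu> (successive_rejects tie As T2 Y) \<le> \<mu> b + 2 * \<gamma> * real (card As - 1)"
    using As sr_remaining_final[OF As tie] by (simp add: card_gt_0_iff)
  also have "\<dots> \<le> \<mu> b + 2 * \<gamma> * real (card As)"
    using \<open>0 \<le> \<gamma>\<close> by (intro add_left_mono mult_left_mono) auto
  finally show ?thesis .
qed

text \<open>The left side is the number of pulls in phase 1, where the denominator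
  \<open>K + 1 - j\<close> is largest; \<open>K \<le> T2\<close> keeps the numerator nonnegative.
  This gives one sample size valid for all phases.\<close>

lemma sr_pulls_mono:
  assumes "1 \<le> j" "j < K" "K \<le> T2"
  shows "nat \<lceil>(real T2 - real K) / (log_bar K * real K)\<rceil> \<le> sr_pulls K T2 j"
proof -
  have "0 < log_bar K"
    unfolding log_bar_def by (intro add_pos_nonneg sum_nonneg) auto
  then have "(real T2 - real K) / (log_bar K * real K) \<le>
    (real T2 - real K) / (log_bar K * (real K + 1 - real j))"
    using assms by (intro divide_left_mono mult_left_mono) auto
  then have "nat \<lceil>(real T2 - real K) / (log_bar K * real K)\<rceil> \<le>
    nat \<lceil>(real T2 - real K) / (log_bar K * (real K + 1 - real j))\<rceil>"
    by (intro nat_mono ceiling_mono)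
  then show ?thesis
    using assms by (simp only: sr_pulls_def) simp
qed

subsection \<open>Measurability of the algorithm\<close>

text \<open>A description without sorting: a maximum of finitely many finite sums, from which
  measurability is immediate.\<close>

lemma top_sum_eq_Max:
  assumes "k \<le> N"
  shows "top_sum k (map f [0..<N]) = Max (sum f ` {S. S \<subseteq> {..<N} \<and> card S = k})"
proof (rule Max_eqI[symmetric])
  show "finite (sum f ` {S. S \<subseteq> {..<N} \<and> card S = k})" by simp
  show "y \<le> top_sum k (map f [0..<N])" if "y \<in> sum f ` {S. S \<subseteq> {..<N} \<and> card S = k}" for y
    using that sum_le_top_sum assms by auto
  show "top_sum k (map f [0..<N]) \<in> sum f ` {S. S \<subseteq> {..<N} \<and> card S = k}"
    using sorted_top_set[OF assms, of f] by (force simp: top_sets_def)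
qed

lemma borel_measurable_top_sum:
  assumes "k \<le> N" and [measurable]: "\<And>j. j < N \<Longrightarrow> f j \<in> borel_measurable M"
  shows "(\<lambda>x. top_sum k (map (\<lambda>j. f j x) [0..<N])) \<in> borel_measurable M"
proof -
  have "(\<lambda>x. Max ((\<lambda>S. \<Sum>j\<in>S. f j x) ` {S. S \<subseteq> {..<N} \<and> card S = k})) \<in> borel_measurable M"
  proof (intro borel_measurable_Max borel_measurable_sum)
    fix S j assume "S \<in> {S. S \<subseteq> {..<N} \<and> card S = k}" "j \<in> S"
    then have "j < N" by blast
    then show "f j \<in> borel_measurable M" by (rule assms(2))
  next
    show "finite {S. S \<subseteq> {..<N} \<and> card S = k}"
      by (rule finite_subset[of _ "Pow {..<N}"]) auto
  qed
  then show ?thesis using assms(1) by (simp add: top_sum_eq_Max)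
qed

text \<open>Tie breaking is an arbitrary function of the candidate set. Once that set is a
  measurable map into a finite discrete space, any function of it is measurable.\<close>

lemma measurable_finite_set_valued:
  assumes "finite A" and sub: "\<And>x. x \<in> space M \<Longrightarrow> S x \<subseteq> A"
    and meas: "\<And>a. a \<in> A \<Longrightarrow> {x \<in> space M. a \<in> S x} \<in> sets M"
  shows "S \<in> M \<rightarrow>\<^sub>M count_space (Pow A)"
proof -
  have "S -` {B} \<inter> space M \<in> sets M" if "B \<subseteq> A" for B
  proof -
    have [measurable]: "Measurable.pred M (\<lambda>x. a \<in> S x)" if "a \<in> A" for a
      using meas[OF that] by (simp add: pred_def)
    have "S -` {B} \<inter> space M = {x \<in> space M. \<forall>a\<in>A. a \<in> S x \<longleftrightarrow> a \<in> B}"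
      using sub \<open>B \<subseteq> A\<close> by blast
    also have "\<dots> \<in> sets M"
      using \<open>finite A\<close> by measurable
    finally show ?thesis .
  qed
  then show ?thesis
    using assms(1) sub by (subst measurable_count_space_eq2) auto
qed

lemma measurable_top_sets:
  fixes f :: "nat \<Rightarrow> 'a \<Rightarrow> real"
  assumes [measurable]: "\<And>j. f j \<in> borel_measurable M"
  shows "(\<lambda>x. top_sets k N (\<lambda>j. f j x)) \<in> M \<rightarrow>\<^sub>M count_space (Pow (Pow {..<N}))"
proof (rule measurable_finite_set_valued)
  fix S :: "nat set" assume "S \<in> Pow {..<N}"
  then have [simp]: "finite S" by (auto dest: finite_subset)
  have "{x \<in> space M. \<forall>i\<in>S. \<forall>j\<in>{..<N} - S. f j x \<le> f i x} \<in> sets M"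
    by measurable
  moreover have "{x \<in> space M. S \<in> top_sets k N (\<lambda>j. f j x)} =
    (if card S = k then {x \<in> space M. \<forall>i\<in>S. \<forall>j\<in>{..<N} - S. f j x \<le> f i x} else {})"
    using \<open>S \<in> Pow {..<N}\<close> by (auto simp: top_sets_def)
  ultimately show "{x \<in> space M. S \<in> top_sets k N (\<lambda>j. f j x)} \<in> sets M" by simp
qed (auto simp: top_sets_def)

lemma measurable_normalize_weights:
  assumes I: "finite I" "I \<noteq> {}"
    and [measurable]: "\<And>c. c \<in> I \<Longrightarrow> (\<lambda>x. r x c) \<in> borel_measurable M"
    and r: "\<And>x c. x \<in> space M \<Longrightarrow> c \<in> I \<Longrightarrow> 0 \<le> r x c"
  shows "(\<lambda>x. normalize_weights I (r x)) \<in> M \<rightarrow>\<^sub>M prob_simplex_space I"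
  unfolding prob_simplex_space_def
proof (rule measurable_restrict_space2)
  show "(\<lambda>x. normalize_weights I (r x)) \<in> space M \<rightarrow> prob_simplex I"
    using r by (auto intro!: normalize_weights_simplex I)
  show "(\<lambda>x. normalize_weights I (r x)) \<in> M \<rightarrow>\<^sub>M Pi\<^sub>M I (\<lambda>_. borel)"
    unfolding normalize_weights_def by (intro measurable_restrict) measurable
qed

lemma measurable_sr_remaining:
  assumes As: "finite As" and tie: "\<forall>j S. S \<noteq> {} \<longrightarrow> tie j S \<in> S"
    and Y: "\<And>a s. a \<in> As \<Longrightarrow> (\<lambda>x. Y x a s) \<in> borel_measurable M"
  shows "(\<lambda>x. sr_remaining tie As T2 (Y x) j) \<in> M \<rightarrow>\<^sub>M count_space (Pow As)"
proof (induction j)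
  case 0
  then show ?case by simp
next
  case (Suc j)
  define e where "e x = empirical_mean (Y x) (sr_pulls (card As) T2 (Suc j))" for x
  have [measurable]: "(\<lambda>x. e x a) \<in> borel_measurable M" if "a \<in> As" for a
    unfolding e_def empirical_mean_def using Y[OF that] by measurable
  have worst: "(\<lambda>x. {a \<in> R. \<forall>b\<in>R. e x b \<le> e x a}) \<in> M \<rightarrow>\<^sub>M count_space (Pow As)"
    if "R \<subseteq> As" for R
  proof (rule measurable_finite_set_valued[OF As])
    fix a assume "a \<in> As"
    have fin: "finite R" using that As finite_subset by blast
    have "{x \<in> space M. \<forall>b\<in>R. e x b \<le> e x a} \<in> sets M"
    proof (rule sets.sets_Collect_finite_All[OF _ fin])
      fix b assume "b \<in> R"
      then show "{x \<in> space M. e x b \<le> e x a} \<in> sets M"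
        using that \<open>a \<in> As\<close> by (intro borel_measurable_le) auto
    qed
    then show "{x \<in> space M. a \<in> {a \<in> R. \<forall>b\<in>R. e x b \<le> e x a}} \<in> sets M"
      by (cases "a \<in> R") auto
  qed (use that in auto)
  \<comment> \<open>The set remaining after \<open>j\<close> phases has finitely many possible
    values; fixing it as \<open>R\<close> leaves only the dependence on the empirical means.\<close>
  have "(\<lambda>x. (\<lambda>R x. R - {tie (Suc j) {a \<in> R. \<forall>b\<in>R. e x b \<le> e x a}})
      (sr_remaining tie As T2 (Y x) j) x) \<in> M \<rightarrow>\<^sub>M count_space (Pow As)"
  proof (rule measurable_compose_countable'[OF _ Suc])
    fix R assume "R \<in> Pow As"
    then have "(\<lambda>S. R - {tie (Suc j) S}) \<in> count_space (Pow As) \<rightarrow>\<^sub>M count_space (Pow As)"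
      by auto
    from measurable_compose[OF worst this] \<open>R \<in> Pow As\<close>
    show "(\<lambda>x. R - {tie (Suc j) {a \<in> R. \<forall>b\<in>R. e x b \<le> e x a}}) \<in> M \<rightarrow>\<^sub>M count_space (Pow As)"
      by auto
  qed (use As in \<open>simp add: countable_finite\<close>)
  then show ?case by (simp add: Let_def e_def)
qed

lemma measurable_successive_rejects:
  assumes "finite As" "As \<noteq> {}" "\<forall>j S. S \<noteq> {} \<longrightarrow> tie j S \<in> S"
    and "\<And>a s. a \<in> As \<Longrightarrow> (\<lambda>x. Y x a s) \<in> borel_measurable M"
  shows "(\<lambda>x. successive_rejects tie As T2 (Y x)) \<in> M \<rightarrow>\<^sub>M count_space As"
proof -
  have "{x \<in> space M. successive_rejects tie As T2 (Y x) = a} \<in> sets M" if "a \<in> As" for a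
  proof -
    have "(\<lambda>x. sr_remaining tie As T2 (Y x) (card As - 1)) -` {{a}} \<inter> space M \<in> sets M"
      by (rule measurable_sets[OF measurable_sr_remaining]) (use assms that in auto)
    also have "(\<lambda>x. sr_remaining tie As T2 (Y x) (card As - 1)) -` {{a}} \<inter> space M =
      {x \<in> space M. successive_rejects tie As T2 (Y x) = a}"
      unfolding sr_remaining_final[OF assms(1-3)] by auto
    finally show ?thesis .
  qed
  then show ?thesis
    using assms(1) successive_rejects_in[OF assms(1-3)]
    by (auto simp: measurable_count_space_eq2 vimage_def Int_def conj_commute)
qed

text \<open>The record type \<open>choices\<close> also has a fact \<open>extend_def\<close>, which shadows that of the constant in \<open>group_loss\<close>.\<close>

hide_fact choices.extend_def

section \<open>A fixed instance: bounds and measurability of its losses\<close>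

locale rposst_instance =
  fixes Q :: "('t, 'p) problem" and Ch :: "('t, 'p) choices" and G Lbar :: real
    and k N m :: nat and \<tau>0 :: "'t set"
  assumes valid: "valid_problem Q" and bounded: "losses_bounded Q Lbar"
    and choices: "valid_choices Q m \<tau>0 G Ch" and \<tau>0: "\<tau>0 \<subseteq> tests Q"
    and k: "1 \<le> k" and kN: "k \<le> N" and m: "1 \<le> m" and Lbar: "0 < Lbar"
begin

abbreviation "Coords \<equiv> coords m \<tau>0"
abbreviation "Weights \<equiv> prob_simplex Coords"
abbreviation "Groups \<equiv> groups Q m"
abbreviation "gloss \<equiv> group_loss Q m \<tau>0"
abbreviation "weights_at \<equiv> round_weights Q Ch k N m \<tau>0"

text \<open>The sum, not the average, of the \<open>k\<close> largest losses; hence the factors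
  \<open>real k\<close> in what follows.\<close>

definition sample_loss :: "'t list \<Rightarrow> (nat + 't \<Rightarrow> real) \<Rightarrow> (nat \<Rightarrow> 'p \<times> ('t \<Rightarrow> real)) \<Rightarrow> real" where
  "sample_loss \<tau> w Z = top_sum k (map (\<lambda>j. gloss \<tau> w (Z j)) [0..<N])"

sublocale prob_space "Psi Q"
  using valid by (simp add: valid_problem_def)

lemma sets_Psi [measurable_cong]:
  "sets (Psi Q) = sets (count_space (policies Q) \<Otimes>\<^sub>M prob_simplex_space (tests Q))"
  using valid by (simp add: valid_problem_def)

lemma space_prob_simplex_space: "space (prob_simplex_space J) = prob_simplex J"
  by (auto simp: prob_simplex_space_def space_restrict_space space_PiM prob_simplex_def PiE_def)

lemma space_Psi: "space (Psi Q) = policies Q \<times> prob_simplex (tests Q)"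
  using sets_eq_imp_space_eq[OF sets_Psi] by (simp add: space_pair_measure space_prob_simplex_space)

lemma finite_tests: "finite (tests Q)" and finite_policies: "finite (policies Q)"
  using valid by (auto simp: valid_problem_def)

lemma tests_nonempty: "tests Q \<noteq> {}"
  using not_empty by (auto simp: space_Psi prob_simplex_def)

lemma finite_Coords: "finite Coords" and Coords_nonempty: "Coords \<noteq> {}"
  and card_Coords: "card Coords = m + card \<tau>0"
  using finite_subset[OF \<tau>0 finite_tests] m by (auto simp: coords_def card_Plus lessThan_empty_iff bot_nat_def)

lemma finite_Groups: "finite Groups" and Groups_nonempty: "Groups \<noteq> {}"
proof -
  show "finite Groups"
    using finite_lists_length_eq[OF finite_tests, of m] by (simp add: groups_def)
  obtain x where "x \<in> tests Q" using tests_nonempty by auto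
  then have "replicate m x \<in> Groups" by (auto simp: groups_def)
  then show "Groups \<noteq> {}" by auto
qed

lemma test_of_in: "\<tau> \<in> Groups \<Longrightarrow> c \<in> Coords \<Longrightarrow> test_of \<tau> c \<in> tests Q"
  using \<tau>0 by (auto simp: groups_def coords_def test_of_def)

definition test_weights :: "'t list \<Rightarrow> (nat + 't \<Rightarrow> real) \<Rightarrow> 't \<Rightarrow> real" where
  "test_weights \<tau> w = (\<lambda>x\<in>tests Q. \<Sum>c | c \<in> Coords \<and> test_of \<tau> c = x. w c)"

lemma gloss_eq_loss: "gloss \<tau> w = loss Q (test_weights \<tau> w)"
  by (simp add: fun_eq_iff group_loss_def extend_def test_weights_def)

text \<open>\<open>losses_bounded\<close> speaks of weights on all of \<open>tests Q\<close>. The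
  fibres of \<open>test_of\<close> partition \<open>Coords\<close>, so merging repeated test cases
  preserves the total mass.\<close>

lemma test_weights_simplex:
  assumes "\<tau> \<in> Groups" "w \<in> Weights"
  shows "test_weights \<tau> w \<in> prob_simplex (tests Q)"
proof -
  have "(\<Sum>x\<in>tests Q. \<Sum>c | c \<in> Coords \<and> test_of \<tau> c = x. w c) = (\<Sum>c\<in>Coords. w c)"
    using test_of_in[OF assms(1)] by (intro sum.group finite_Coords finite_tests) auto
  then show ?thesis
    using assms(2) by (auto simp: prob_simplex_def test_weights_def intro!: sum_nonneg)
qed

lemma gloss_bounds:
  "\<tau> \<in> Groups \<Longrightarrow> w \<in> Weights \<Longrightarrow> z \<in> space (Psi Q) \<Longrightarrow> gloss \<tau> w z \<in> {0..Lbar}"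
  using bounded test_weights_simplex[of \<tau> w] unfolding losses_bounded_def gloss_eq_loss space_Psi by blast

lemma sample_loss_bounds:
  "\<tau> \<in> Groups \<Longrightarrow> w \<in> Weights \<Longrightarrow> (\<And>j. j < N \<Longrightarrow> Z j \<in> space (Psi Q)) \<Longrightarrow>
    sample_loss \<tau> w Z \<in> {0..real k * Lbar}"
  unfolding sample_loss_def by (intro top_sum_bounds kN gloss_bounds)

lemma sample_loss_cong:
  "(\<And>j. j < N \<Longrightarrow> Z j = Z' j) \<Longrightarrow> sample_loss \<tau> w Z = sample_loss \<tau> w Z'"
  unfolding sample_loss_def by (intro top_sum_cong) simp

lemma borel_measurable_err [measurable]: "err Q \<in> borel_measurable borel"
proof -
  have "continuous_on UNIV (err Q)"
    using valid by (intro convex_on_continuous) (auto simp: valid_problem_def)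
  then show ?thesis by (rule borel_measurable_continuous_onI)
qed

lemma measurable_simplex_component:
  "c \<in> J \<Longrightarrow> (\<lambda>w. w c) \<in> borel_measurable (prob_simplex_space J)"
  unfolding prob_simplex_space_def by (intro measurable_restrict_space1) simp

lemma measurable_gloss [measurable]:
  assumes \<tau>: "\<tau> \<in> Groups"
  shows "(\<lambda>(w, z). gloss \<tau> w z) \<in> borel_measurable (prob_simplex_space Coords \<Otimes>\<^sub>M Psi Q)"
proof -
  let ?M = "prob_simplex_space Coords \<Otimes>\<^sub>M Psi Q"
  have w: "(\<lambda>x. fst x c) \<in> borel_measurable ?M" if "c \<in> Coords" for c
    using measurable_compose[OF measurable_fst measurable_simplex_component[OF that]] .
  have 1: "(\<lambda>x. snd (snd x)) \<in> ?M \<rightarrow>\<^sub>M prob_simplex_space (tests Q)"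
    and 2: "(\<lambda>x. fst (snd x)) \<in> ?M \<rightarrow>\<^sub>M count_space (policies Q)"
    by measurable
  have \<sigma>: "(\<lambda>x. snd (snd x) i) \<in> borel_measurable ?M" if "i \<in> tests Q" for i
    using measurable_compose[OF 1 measurable_simplex_component[OF that]] .
  have A: "(\<lambda>x. result Q i (fst (snd x))) \<in> borel_measurable ?M" for i
    using measurable_compose[OF 2, of "result Q i" borel] by simp
  have e: "(\<lambda>x. test_weights \<tau> (fst x) i) \<in> borel_measurable ?M" if "i \<in> tests Q" for i
    using that w by (auto simp: test_weights_def intro!: borel_measurable_sum)
  have 3: "(\<lambda>x. \<Sum>i\<in>tests Q. test_weights \<tau> (fst x) i * result Q i (fst (snd x))) \<in> borel_measurable ?M"
    by (intro borel_measurable_sum borel_measurable_times A e)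
  have 4: "(\<lambda>x. \<Sum>i\<in>tests Q. snd (snd x) i * result Q i (fst (snd x))) \<in> borel_measurable ?M"
    by (intro borel_measurable_sum borel_measurable_times A \<sigma>)
  from measurable_compose[OF measurable_Pair[OF 3 4], of "err Q" borel]
  show ?thesis
    by (simp add: gloss_eq_loss loss_def split_beta' borel_prod)
qed

lemma measurable_sample_loss:
  assumes "\<tau> \<in> Groups" and w: "w \<in> M \<rightarrow>\<^sub>M prob_simplex_space Coords"
    and Z: "\<And>j. j < N \<Longrightarrow> (\<lambda>x. Z x j) \<in> M \<rightarrow>\<^sub>M Psi Q"
  shows "(\<lambda>x. sample_loss \<tau> (w x) (Z x)) \<in> borel_measurable M"
  unfolding sample_loss_def
  using measurable_compose[OF measurable_Pair[OF w Z] measurable_gloss[OF assms(1)]]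
  by (intro borel_measurable_top_sum kN) simp

lemma top_tie_in: "F \<noteq> {} \<Longrightarrow> top_tie Ch t \<tau> F \<in> F"
  and arm_tie_in: "\<forall>j S. S \<noteq> {} \<longrightarrow> arm_tie Ch j S \<in> S"
  using choices unfolding valid_choices_def by metis+

section \<open>The optimization game as a function of its samples\<close>

lemma regret_nonneg: "c \<in> Coords \<Longrightarrow> 0 \<le> regret Q Ch k N m \<tau>0 X \<tau> t c"
  by (cases t) (auto simp: Let_def rm_plus_step_def)

lemma regret_cong:
  "(\<And>s j. s \<le> t \<Longrightarrow> X (s, \<tau>, j) = X' (s, \<tau>, j)) \<Longrightarrow>
    regret Q Ch k N m \<tau>0 X \<tau> t = regret Q Ch k N m \<tau>0 X' \<tau> t"
proof (induction t)
  case (Suc t)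
  then have "regret Q Ch k N m \<tau>0 X \<tau> t = regret Q Ch k N m \<tau>0 X' \<tau> t" by simp
  then show ?case using Suc.prems[OF le_refl] by simp
qed simp

lemma measurable_regret:
  assumes "\<tau> \<in> Groups" "c \<in> Coords"
    and "\<And>s j. s \<in> {1..t} \<Longrightarrow> (\<lambda>x. X x (s, \<tau>, j)) \<in> M \<rightarrow>\<^sub>M Psi Q"
  shows "(\<lambda>x. regret Q Ch k N m \<tau>0 (X x) \<tau> t c) \<in> borel_measurable M"
  using assms
proof (induction t arbitrary: c)
  case 0
  then show ?case by simp
next
  case (Suc t)
  define r where "r x = regret Q Ch k N m \<tau>0 (X x) \<tau> t" for x
  define w where "w x = normalize_weights Coords (r x)" for x
  define Z where "Z x j = X x (Suc t, \<tau>, j)" for x j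
  define F where "F x = top_sets k N (\<lambda>j. gloss \<tau> (w x) (Z x j))" for x
  define v where "v x c = - ((\<Sum>j\<in>top_tie Ch (Suc t) \<tau> (F x). subgrad Ch \<tau> (w x) (Z x j) c) / real k)"
    for x c
  have r [measurable]: "(\<lambda>x. r x c) \<in> borel_measurable M" if "c \<in> Coords" for c
    unfolding r_def by (rule Suc.IH[OF Suc.prems(1) that]) (auto intro: Suc.prems)
  have w: "w \<in> M \<rightarrow>\<^sub>M prob_simplex_space Coords"
    unfolding w_def using regret_nonneg r
    by (intro measurable_normalize_weights finite_Coords Coords_nonempty) (auto simp: r_def)
  have wc [measurable]: "(\<lambda>x. w x c) \<in> borel_measurable M" if "c \<in> Coords" for c
    using measurable_compose[OF w measurable_simplex_component[OF that]] .
  have Z: "(\<lambda>x. Z x j) \<in> M \<rightarrow>\<^sub>M Psi Q" for j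
    unfolding Z_def by (intro Suc.prems) auto
  have F: "F \<in> M \<rightarrow>\<^sub>M count_space (Pow (Pow {..<N}))"
    unfolding F_def
    using measurable_compose[OF measurable_Pair[OF w Z] measurable_gloss[OF Suc.prems(1)]]
    by (intro measurable_top_sets) simp
  have v [measurable]: "(\<lambda>x. v x c) \<in> borel_measurable M" if "c \<in> Coords" for c
  proof -
    have "(\<lambda>(w, z). subgrad Ch \<tau> w z c) \<in> borel_measurable (prob_simplex_space Coords \<Otimes>\<^sub>M Psi Q)"
      using choices Suc.prems(1) that by (auto simp: valid_choices_def)
    from measurable_compose[OF measurable_Pair[OF w Z] this]
    have g: "(\<lambda>x. subgrad Ch \<tau> (w x) (Z x j) c) \<in> borel_measurable M" for j by simp
    \<comment> \<open>The index set chosen by \<open>top_tie\<close> depends on the samples through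
      the finite-valued \<open>F\<close>; for each fixed value of \<open>F\<close> the sum runs over
      a fixed set.\<close>
    have "(\<lambda>x. (\<lambda>F x. \<Sum>j\<in>top_tie Ch (Suc t) \<tau> F. subgrad Ch \<tau> (w x) (Z x j) c) (F x) x)
        \<in> borel_measurable M"
      by (rule measurable_compose_countable'[OF _ F])
        (auto intro!: borel_measurable_sum g countable_finite)
    then show ?thesis unfolding v_def by simp
  qed
  have eq: "regret Q Ch k N m \<tau>0 (X x) \<tau> (Suc t) c =
    max (r x c + (v x c - (\<Sum>d\<in>Coords. w x d * v x d))) 0" for x
    using Suc.prems(2)
    by (simp add: Let_def rm_plus_step_def r_def w_def Z_def F_def v_def)
  show ?case unfolding eq using Suc.prems(2) by measurable
qed

lemma weights_at_simplex: "weights_at X \<tau> t \<in> Weights"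
  unfolding round_weights_def
  by (intro normalize_weights_simplex finite_Coords Coords_nonempty regret_nonneg)

text \<open>The source of the independence between the weights of a round and its own sample. The
  assumption \<open>0 < t\<close> turns \<open>s \<le> t - 1\<close> into
  \<open>s < t\<close>.\<close>

lemma weights_at_cong:
  "(\<And>s j. s < t \<Longrightarrow> X (s, \<tau>, j) = X' (s, \<tau>, j)) \<Longrightarrow> 0 < t \<Longrightarrow> weights_at X \<tau> t = weights_at X' \<tau> t"
  unfolding round_weights_def by (intro arg_cong[of _ _ "normalize_weights Coords"] regret_cong) simp

lemma measurable_weights_at:
  assumes "\<tau> \<in> Groups"
    and "\<And>s j. s \<in> {1..<t} \<Longrightarrow> (\<lambda>x. X x (s, \<tau>, j)) \<in> M \<rightarrow>\<^sub>M Psi Q"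
  shows "(\<lambda>x. weights_at (X x) \<tau> t) \<in> M \<rightarrow>\<^sub>M prob_simplex_space Coords"
  unfolding round_weights_def using assms
  by (intro measurable_normalize_weights finite_Coords Coords_nonempty measurable_regret regret_nonneg) auto

text \<open>
  The average subgradient of the \<open>k\<close> largest losses is a subgradient of the average of the
  \<open>k\<close> largest losses: at \<open>u\<close>, the losses at any \<open>k\<close> indices are dominated by the \<open>k\<close> largest.
\<close>

lemma sample_loss_regret_le:
  assumes \<tau>: "\<tau> \<in> Groups" and u: "u \<in> Weights"
    and X: "\<And>t j. t \<in> {1..T} \<Longrightarrow> X (t, \<tau>, j) \<in> space (Psi Q)"
  shows "(\<Sum>t\<in>{1..T}. sample_loss \<tau> (weights_at X \<tau> t) (\<lambda>j. X (t, \<tau>, j)) -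
      sample_loss \<tau> u (\<lambda>j. X (t, \<tau>, j))) \<le>
    real k * (2 * \<bar>G\<bar> * sqrt (real T * real (card Coords)))"
proof -
  define r where "r = regret Q Ch k N m \<tau>0 X \<tau>"
  define w where "w t = normalize_weights Coords (r t)" for t
  \<comment> \<open>Index shift: \<open>Z t\<close> is the sample of round \<open>Suc t\<close>,
    which plays the normalization of \<open>r t\<close>.\<close>
  define Z where "Z t j = X (Suc t, \<tau>, j)" for t j
  define S where "S t = top_tie Ch (Suc t) \<tau> (top_sets k N (\<lambda>j. gloss \<tau> (w t) (Z t j)))" for t
  define v where "v t c = - ((\<Sum>j\<in>S t. subgrad Ch \<tau> (w t) (Z t j) c) / real k)" for t c
  have S: "S t \<in> top_sets k N (\<lambda>j. gloss \<tau> (w t) (Z t j))" for t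
    unfolding S_def by (rule top_tie_in[OF top_sets_nonempty[OF kN]])
  then have S': "S t \<subseteq> {..<N}" "card (S t) = k" for t by (auto simp: top_sets_def)
  have w: "w t \<in> Weights" for t
    unfolding w_def r_def by (intro normalize_weights_simplex finite_Coords Coords_nonempty regret_nonneg)
  have Z: "Z t j \<in> space (Psi Q)" if "t < T" for t j unfolding Z_def using that by (intro X) auto
  have ch: "is_subgradient Coords (\<lambda>w'. gloss \<tau> w' z) w (subgrad Ch \<tau> w z) \<and>
      (\<forall>c\<in>Coords. \<bar>subgrad Ch \<tau> w z c\<bar> \<le> G)" if "w \<in> Weights" "z \<in> space (Psi Q)" for w z
  proof -
    have "\<forall>\<tau>\<in>Groups. \<forall>w\<in>Weights. \<forall>z\<in>space (Psi Q).
      is_subgradient Coords (\<lambda>w'. gloss \<tau> w' z) w (subgrad Ch \<tau> w z) \<and>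
      (\<forall>c\<in>Coords. \<bar>subgrad Ch \<tau> w z c\<bar> \<le> G)"
      using choices unfolding valid_choices_def space_Psi by (rule conjunct1)
    from bspec[OF bspec[OF bspec[OF this \<tau>] that(1)] that(2)] show ?thesis .
  qed
  have sub: "is_subgradient Coords (\<lambda>w'. gloss \<tau> w' (Z t j)) (w t) (subgrad Ch \<tau> (w t) (Z t j))"
    and G: "\<forall>c\<in>Coords. \<bar>subgrad Ch \<tau> (w t) (Z t j) c\<bar> \<le> G" if "t < T" for t j
    using ch[OF w Z[OF that]] by auto
  have v: "\<bar>v t c\<bar> \<le> G" if "t < T" "c \<in> Coords" for t c
  proof -
    have "\<bar>\<Sum>j\<in>S t. subgrad Ch \<tau> (w t) (Z t j) c\<bar> \<le> (\<Sum>j\<in>S t. \<bar>subgrad Ch \<tau> (w t) (Z t j) c\<bar>)"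
      by (rule sum_abs)
    also have "\<dots> \<le> real (card (S t)) * G" by (intro sum_bounded_above bspec[OF G] that)
    finally have "\<bar>\<Sum>j\<in>S t. subgrad Ch \<tau> (w t) (Z t j) c\<bar> \<le> G * real k"
      unfolding S' by (simp only: mult.commute)
    then show ?thesis using k by (simp add: v_def pos_divide_le_eq)
  qed
  have step: "sample_loss \<tau> (w t) (Z t) - sample_loss \<tau> u (Z t) \<le>
    real k * (\<Sum>c\<in>Coords. (u c - w t c) * v t c)" if "t < T" for t
  proof -
    have "(\<Sum>j\<in>S t. gloss \<tau> (w t) (Z t j) + (\<Sum>c\<in>Coords. subgrad Ch \<tau> (w t) (Z t j) c * (u c - w t c))) \<le>
      (\<Sum>j\<in>S t. gloss \<tau> u (Z t j))"
      using sub[OF that] unfolding is_subgradient_def by (intro sum_mono) blast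
    also have "\<dots> \<le> sample_loss \<tau> u (Z t)"
      unfolding sample_loss_def by (intro sum_le_top_sum S' kN)
    finally have "(\<Sum>j\<in>S t. gloss \<tau> (w t) (Z t j)) +
      (\<Sum>j\<in>S t. \<Sum>c\<in>Coords. subgrad Ch \<tau> (w t) (Z t j) c * (u c - w t c)) \<le> sample_loss \<tau> u (Z t)"
      by (simp add: sum.distrib)
    moreover have "(\<Sum>j\<in>S t. gloss \<tau> (w t) (Z t j)) = sample_loss \<tau> (w t) (Z t)"
      unfolding sample_loss_def by (rule top_sum_eq_sum_top_set[OF S kN, symmetric])
    \<comment> \<open>\<open>v\<close> is minus the average subgradient, so the linearized loss
      difference becomes the gain of \<open>u\<close> over the played weights.\<close>
    moreover have "(\<Sum>j\<in>S t. \<Sum>c\<in>Coords. subgrad Ch \<tau> (w t) (Z t j) c * (u c - w t c)) =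
      - (real k * (\<Sum>c\<in>Coords. (u c - w t c) * v t c))"
    proof -
      have "(\<Sum>j\<in>S t. \<Sum>c\<in>Coords. subgrad Ch \<tau> (w t) (Z t j) c * (u c - w t c)) =
        (\<Sum>c\<in>Coords. (\<Sum>j\<in>S t. subgrad Ch \<tau> (w t) (Z t j) c) * (u c - w t c))"
        by (subst sum.swap) (simp add: sum_distrib_right)
      also have "\<dots> = (\<Sum>c\<in>Coords. - (real k * ((u c - w t c) * v t c)))"
        using k by (intro sum.cong refl) (simp add: v_def)
      finally show ?thesis by (simp add: sum_negf sum_distrib_left)
    qed
    ultimately show ?thesis by simp
  qed
  have "(\<Sum>t\<in>{1..T}. sample_loss \<tau> (weights_at X \<tau> t) (\<lambda>j. X (t, \<tau>, j)) -
      sample_loss \<tau> u (\<lambda>j. X (t, \<tau>, j))) =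
    (\<Sum>t<T. sample_loss \<tau> (w t) (Z t) - sample_loss \<tau> u (Z t))"
    unfolding One_nat_def sum.atLeast1_atMost_eq by (simp add: round_weights_def w_def r_def Z_def[abs_def])
  also have "\<dots> \<le> (\<Sum>t<T. real k * (\<Sum>c\<in>Coords. (u c - w t c) * v t c))"
    by (intro sum_mono step) auto
  also have "\<dots> = real k * (\<Sum>t<T. \<Sum>c\<in>Coords. (u c - w t c) * v t c)"
    by (simp add: sum_distrib_left)
  also have "\<dots> \<le> real k * (2 * \<bar>G\<bar> * sqrt (real T * real (card Coords)))"
    unfolding w_def
  proof (intro mult_left_mono rm_plus_regret_le finite_Coords Coords_nonempty v u)
    show "r (Suc t) = rm_plus_step Coords (v t) (r t)" for t
      by (simp only: r_def regret.simps Let_def v_def[abs_def] S_def w_def Z_def[abs_def])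
  qed (simp_all add: r_def)
  finally show ?thesis .
qed

end

subsection \<open>Expected losses\<close>

context prob_space
begin

lemma prob_space_PiM_iid: "prob_space (\<Pi>\<^sub>M i\<in>I. M)"
  by (rule prob_space_PiM) unfold_locales

lemma distr_PiM_iid_restrict:
  "distr (\<Pi>\<^sub>M i\<in>UNIV. M) (\<Pi>\<^sub>M i\<in>A. M) (\<lambda>X. restrict X A) = (\<Pi>\<^sub>M i\<in>A. M)"
  using distr_PiM_reindex[of UNIV "\<lambda>_. M" "\<lambda>i. i" A] prob_space_axioms by simp

lemma indep_vars_PiM_iid:
  "prob_space.indep_vars (\<Pi>\<^sub>M i\<in>UNIV. M) (\<lambda>_. M) (\<lambda>i X. X i) UNIV"
proof -
  interpret PP: prob_space "\<Pi>\<^sub>M i\<in>UNIV. M" by (rule prob_space_PiM_iid)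
  have "distr (\<Pi>\<^sub>M i\<in>UNIV. M) M (\<lambda>X. X i) = M" for i :: 'b
    using prob_space_axioms by (intro distr_PiM_component) auto
  then show ?thesis
    by (subst PP.indep_vars_iff_distr_eq_PiM') (simp_all add: distr_PiM_iid_restrict)
qed

lemma integral_PiM_iid_split:
  fixes F :: "('i \<Rightarrow> 'a) \<times> ('i \<Rightarrow> 'a) \<Rightarrow> real"
  assumes AB: "A \<inter> B = {}"
    and F [measurable]: "F \<in> borel_measurable ((\<Pi>\<^sub>M i\<in>A. M) \<Otimes>\<^sub>M (\<Pi>\<^sub>M i\<in>B. M))"
    and bound: "\<And>x. x \<in> space ((\<Pi>\<^sub>M i\<in>A. M) \<Otimes>\<^sub>M (\<Pi>\<^sub>M i\<in>B. M)) \<Longrightarrow> \<bar>F x\<bar> \<le> c"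
  shows "(\<integral>X. F (restrict X A, restrict X B) \<partial>(\<Pi>\<^sub>M i\<in>UNIV. M)) =
    (\<integral>X. (\<integral>Y. F (restrict X A, Y) \<partial>(\<Pi>\<^sub>M i\<in>B. M)) \<partial>(\<Pi>\<^sub>M i\<in>UNIV. M))"
proof -
  let ?U = "\<Pi>\<^sub>M i\<in>UNIV. M" and ?A = "\<Pi>\<^sub>M i\<in>A. M" and ?B = "\<Pi>\<^sub>M i\<in>B. M"
  interpret PU: prob_space ?U by (rule prob_space_PiM_iid)
  interpret PA: prob_space ?A by (rule prob_space_PiM_iid)
  interpret PB: prob_space ?B by (rule prob_space_PiM_iid)
  interpret AB: pair_prob_space ?A ?B by unfold_locales
  have [measurable]: "(\<lambda>X. restrict X A) \<in> ?U \<rightarrow>\<^sub>M ?A" "(\<lambda>X. restrict X B) \<in> ?U \<rightarrow>\<^sub>M ?B"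
    by (auto intro!: measurable_restrict_subset)
  have "PU.indep_var ?A (\<lambda>X. restrict X A) ?B (\<lambda>X. restrict X B)"
    using PU.indep_var_restrict[OF indep_vars_PiM_iid AB] by simp
  then have dist: "distr ?U (?A \<Otimes>\<^sub>M ?B) (\<lambda>X. (restrict X A, restrict X B)) = ?A \<Otimes>\<^sub>M ?B"
    unfolding PU.indep_var_distribution_eq distr_PiM_iid_restrict by simp
  have int: "integrable (?A \<Otimes>\<^sub>M ?B) F"
    using bound by (intro AB.P.integrable_const_bound[where B=c]) auto
  have "(\<integral>X. F (restrict X A, restrict X B) \<partial>?U) = integral\<^sup>L (?A \<Otimes>\<^sub>M ?B) F"
    by (subst dist[symmetric], subst integral_distr) auto
  also have "\<dots> = (\<integral>a. (\<integral>b. F (a, b) \<partial>?B) \<partial>?A)"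
    using int by (rule AB.integral_fst'[symmetric])
  also have "\<dots> = (\<integral>X. (\<integral>b. F (restrict X A, b) \<partial>?B) \<partial>?U)"
    by (subst distr_PiM_iid_restrict[of A, symmetric], subst integral_distr) auto
  finally show ?thesis .
qed

end

context rposst_instance
begin

abbreviation "risk \<equiv> k_of_N_loss Q k N m \<tau>0"
abbreviation "Runs \<equiv> (\<Pi>\<^sub>M i\<in>(UNIV :: (nat \<times> 't list \<times> nat) set). Psi Q)"

lemma measurable_gloss_at:
  assumes "\<tau> \<in> Groups" "w \<in> Weights"
  shows "gloss \<tau> w \<in> borel_measurable (Psi Q)"
  using measurable_Pair2[OF measurable_gloss[OF assms(1)], of w] assms(2)
  by (simp add: space_prob_simplex_space)

lemma risk_eq:
  assumes "\<tau> \<in> Groups" "w \<in> Weights"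
  shows "risk \<tau> w = (\<integral>Z. sample_loss \<tau> w Z \<partial>(\<Pi>\<^sub>M j\<in>{..<N}. Psi Q)) / real k"
  unfolding k_of_N_loss_def sample_loss_def
  by (rule percentile_loss_k_of_N[OF measurable_gloss_at[OF assms] gloss_bounds[OF assms] k kN])

text \<open>Distinct coordinates of an i.i.d. family form an i.i.d. sample again; the loss reads the
  first \<open>N\<close> of them.\<close>

lemma expectation_sample_loss:
  fixes \<iota> :: "nat \<Rightarrow> 'i"
  assumes "\<tau> \<in> Groups" "w \<in> Weights" and \<iota>: "inj \<iota>" "range \<iota> \<subseteq> I"
  shows "(\<integral>X. sample_loss \<tau> w (\<lambda>j. X (\<iota> j)) \<partial>(\<Pi>\<^sub>M i\<in>I. Psi Q)) = real k * risk \<tau> w"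
proof -
  have meas: "sample_loss \<tau> w \<in> borel_measurable (\<Pi>\<^sub>M j\<in>{..<N}. Psi Q)"
    using assms(2) by (intro measurable_sample_loss[of \<tau> "\<lambda>_. w" _ "\<lambda>x. x"] assms(1))
      (auto simp: space_prob_simplex_space)
  have "(\<integral>X. sample_loss \<tau> w (\<lambda>j. X (\<iota> j)) \<partial>(\<Pi>\<^sub>M i\<in>I. Psi Q)) =
    (\<integral>X. sample_loss \<tau> w (\<lambda>j\<in>{..<N}. X (\<iota> j)) \<partial>(\<Pi>\<^sub>M i\<in>I. Psi Q))"
    by (intro Bochner_Integration.integral_cong refl sample_loss_cong) simp
  also have "\<dots> = integral\<^sup>L (distr (\<Pi>\<^sub>M i\<in>I. Psi Q) (\<Pi>\<^sub>M j\<in>{..<N}. Psi Q) (\<lambda>X. \<lambda>j\<in>{..<N}. X (\<iota> j)))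
      (sample_loss \<tau> w)"
    using \<iota> by (intro integral_distr[symmetric] meas measurable_restrict measurable_component_singleton) auto
  also have "distr (\<Pi>\<^sub>M i\<in>I. Psi Q) (\<Pi>\<^sub>M j\<in>{..<N}. Psi Q) (\<lambda>X. \<lambda>j\<in>{..<N}. X (\<iota> j)) =
      (\<Pi>\<^sub>M j\<in>{..<N}. Psi Q)"
    using \<iota> prob_space_axioms by (intro distr_PiM_reindex) (auto intro: inj_on_subset)
  finally show ?thesis using k by (simp add: risk_eq[OF assms(1,2)])
qed

lemma risk_bounds:
  assumes "\<tau> \<in> Groups" "w \<in> Weights"
  shows "risk \<tau> w \<in> {0..Lbar}"
proof -
  interpret PP: prob_space "\<Pi>\<^sub>M j\<in>{..<N}. Psi Q" by (rule prob_space_PiM_iid)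
  have meas: "sample_loss \<tau> w \<in> borel_measurable (\<Pi>\<^sub>M j\<in>{..<N}. Psi Q)"
    using assms(2) by (intro measurable_sample_loss[of \<tau> "\<lambda>_. w" _ "\<lambda>x. x"] assms(1))
      (auto simp: space_prob_simplex_space)
  have b: "sample_loss \<tau> w Z \<in> {0..real k * Lbar}" if "Z \<in> space (\<Pi>\<^sub>M j\<in>{..<N}. Psi Q)" for Z
    using that by (intro sample_loss_bounds assms) (auto simp: space_PiM PiE_iff)
  then have int: "integrable (\<Pi>\<^sub>M j\<in>{..<N}. Psi Q) (sample_loss \<tau> w)"
    by (intro PP.integrable_const_bound[where B="real k * Lbar"] meas AE_I2) auto
  have "0 \<le> (\<integral>Z. sample_loss \<tau> w Z \<partial>(\<Pi>\<^sub>M j\<in>{..<N}. Psi Q))"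
    using b by (intro Bochner_Integration.integral_nonneg) auto
  moreover have "(\<integral>Z. sample_loss \<tau> w Z \<partial>(\<Pi>\<^sub>M j\<in>{..<N}. Psi Q)) \<le> real k * Lbar"
    using b by (intro PP.integral_le_const int AE_I2) auto
  ultimately show ?thesis using k by (simp add: risk_eq[OF assms] field_simps)
qed

text \<open>The infimum in the percentile loss ranges over an uncountable family; by
  \<open>risk_eq\<close> the risk is instead an integral with \<open>w\<close> as parameter, which
  is measurable in \<open>w\<close>.\<close>

lemma measurable_risk:
  assumes "\<tau> \<in> Groups" and w: "w \<in> M \<rightarrow>\<^sub>M prob_simplex_space Coords"
  shows "(\<lambda>x. risk \<tau> (w x)) \<in> borel_measurable M"
proof -
  interpret PP: prob_space "\<Pi>\<^sub>M j\<in>{..<N}. Psi Q" by (rule prob_space_PiM_iid)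
  have "(\<lambda>x. sample_loss \<tau> (fst x) (snd x)) \<in>
      borel_measurable (prob_simplex_space Coords \<Otimes>\<^sub>M (\<Pi>\<^sub>M j\<in>{..<N}. Psi Q))"
    by (intro measurable_sample_loss assms(1)) auto
  then have "(\<lambda>w. (\<integral>Z. sample_loss \<tau> w Z \<partial>(\<Pi>\<^sub>M j\<in>{..<N}. Psi Q)) / real k)
      \<in> borel_measurable (prob_simplex_space Coords)"
    by (intro borel_measurable_divide PP.borel_measurable_lebesgue_integral) (auto simp: split_beta')
  then have "risk \<tau> \<in> borel_measurable (prob_simplex_space Coords)"
    by (rule measurable_cong[THEN iffD1, rotated])
      (simp add: space_prob_simplex_space risk_eq[OF assms(1)])
  from measurable_compose[OF w this] show ?thesis .
qed

lemma integrable_risk: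
  assumes "prob_space M" "\<tau> \<in> Groups" "w \<in> M \<rightarrow>\<^sub>M prob_simplex_space Coords"
  shows "integrable M (\<lambda>x. risk \<tau> (w x))"
proof -
  interpret M: prob_space M by fact
  have "w x \<in> Weights" if "x \<in> space M" for x
    using measurable_space[OF assms(3) that] by (simp add: space_prob_simplex_space)
  then show ?thesis
    using risk_bounds[OF assms(2)]
    by (intro M.integrable_const_bound[where B=Lbar] measurable_risk assms AE_I2) auto
qed

text \<open>Integrating out the samples \<open>B\<close> of round \<open>t\<close> first, with the
  weights frozen by the samples \<open>A\<close> of earlier rounds, leaves the risk of these
  weights.\<close>

lemma expectation_round_loss:
  assumes \<tau>: "\<tau> \<in> Groups" and "0 < t"
  shows "(\<integral>X. sample_loss \<tau> (weights_at X \<tau> t) (\<lambda>j. X (t, \<tau>, j)) \<partial>Runs) =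
    real k * (\<integral>X. risk \<tau> (weights_at X \<tau> t) \<partial>Runs)"
proof -
  define A B :: "(nat \<times> 't list \<times> nat) set" where "A = {..<t} \<times> UNIV" and "B = {t} \<times> UNIV"
  define F where "F = (\<lambda>(a, b). sample_loss \<tau> (weights_at a \<tau> t) (\<lambda>j. b (t, \<tau>, j)))"
  have loc: "weights_at (restrict X A) \<tau> t = weights_at X \<tau> t" for X
    using \<open>0 < t\<close> by (intro weights_at_cong) (auto simp: A_def)
  have meas: "F \<in> borel_measurable ((\<Pi>\<^sub>M i\<in>A. Psi Q) \<Otimes>\<^sub>M (\<Pi>\<^sub>M i\<in>B. Psi Q))"
    unfolding F_def split_beta'
  proof (intro measurable_sample_loss \<tau> measurable_weights_at)
    fix s j assume "s \<in> {1..<t}"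
    then have "(s, \<tau>, j) \<in> A" by (simp add: A_def)
    then show "(\<lambda>x. fst x (s, \<tau>, j)) \<in> (\<Pi>\<^sub>M i\<in>A. Psi Q) \<Otimes>\<^sub>M (\<Pi>\<^sub>M i\<in>B. Psi Q) \<rightarrow>\<^sub>M Psi Q"
      by (intro measurable_compose[OF measurable_fst] measurable_component_singleton)
  next
    fix j
    have "(t, \<tau>, j) \<in> B" by (simp add: B_def)
    then show "(\<lambda>x. snd x (t, \<tau>, j)) \<in> (\<Pi>\<^sub>M i\<in>A. Psi Q) \<Otimes>\<^sub>M (\<Pi>\<^sub>M i\<in>B. Psi Q) \<rightarrow>\<^sub>M Psi Q"
      by (intro measurable_compose[OF measurable_snd] measurable_component_singleton)
  qed
  have bound: "\<bar>F x\<bar> \<le> real k * Lbar" if "x \<in> space ((\<Pi>\<^sub>M i\<in>A. Psi Q) \<Otimes>\<^sub>M (\<Pi>\<^sub>M i\<in>B. Psi Q))" for x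
  proof -
    have "F x \<in> {0..real k * Lbar}"
      unfolding F_def split_beta' using that
      by (intro sample_loss_bounds \<tau> weights_at_simplex)
        (auto simp: space_pair_measure space_PiM PiE_iff B_def)
    then show ?thesis by simp
  qed
  have "(\<integral>X. sample_loss \<tau> (weights_at X \<tau> t) (\<lambda>j. X (t, \<tau>, j)) \<partial>Runs) =
    (\<integral>X. F (restrict X A, restrict X B) \<partial>Runs)"
    by (simp add: F_def loc B_def)
  also have "\<dots> = (\<integral>X. (\<integral>Y. F (restrict X A, Y) \<partial>(\<Pi>\<^sub>M i\<in>B. Psi Q)) \<partial>Runs)"
    by (intro integral_PiM_iid_split[OF _ meas bound]) (auto simp: A_def B_def)
  also have "\<dots> = (\<integral>X. real k * risk \<tau> (weights_at X \<tau> t) \<partial>Runs)"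
    unfolding F_def split loc
    by (intro Bochner_Integration.integral_cong refl expectation_sample_loss \<tau> weights_at_simplex)
      (auto simp: inj_def B_def)
  finally show ?thesis by simp
qed

text \<open>The sure regret bound in expectation. As \<open>u\<close> does not depend on the
  samples, its sampled loss has mean \<open>k * risk \<tau> u\<close> in each round; dividing by
  \<open>k\<close> undoes the scaling of \<open>sample_loss\<close>.\<close>

lemma sum_expected_risk_le:
  assumes \<tau>: "\<tau> \<in> Groups" and u: "u \<in> Weights"
  shows "(\<Sum>t\<in>{1..T}. (\<integral>X. risk \<tau> (weights_at X \<tau> t) \<partial>Runs)) \<le>
    real T * risk \<tau> u + 2 * \<bar>G\<bar> * sqrt (real T * real (card Coords))"
proof -
  interpret PR: prob_space Runs by (rule prob_space_PiM_iid)
  let ?f = "\<lambda>t X. sample_loss \<tau> (weights_at X \<tau> t) (\<lambda>j. X (t, \<tau>, j))"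
  let ?g = "\<lambda>t X. sample_loss \<tau> u (\<lambda>j. X (t, \<tau>, j))"
  have X: "(\<lambda>X. X i) \<in> Runs \<rightarrow>\<^sub>M Psi Q" for i by simp
  have space: "X i \<in> space (Psi Q)" if "X \<in> space Runs" for X i
    using that by (cases i) (auto simp: space_PiM PiE_iff)
  have int_f: "integrable Runs (?f t)" for t
  proof (rule PR.integrable_const_bound[where B="real k * Lbar"])
    show "AE X in Runs. norm (?f t X) \<le> real k * Lbar"
    proof (rule AE_I2)
      fix X assume "X \<in> space Runs"
      then have "?f t X \<in> {0..real k * Lbar}"
        by (intro sample_loss_bounds \<tau> weights_at_simplex space)
      then show "norm (?f t X) \<le> real k * Lbar" by simp
    qed
  qed (intro measurable_sample_loss \<tau> measurable_weights_at X)
  have int_g: "integrable Runs (?g t)" for t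
  proof (rule PR.integrable_const_bound[where B="real k * Lbar"])
    show "AE X in Runs. norm (?g t X) \<le> real k * Lbar"
    proof (rule AE_I2)
      fix X assume "X \<in> space Runs"
      then have "?g t X \<in> {0..real k * Lbar}"
        by (intro sample_loss_bounds \<tau> u space)
      then show "norm (?g t X) \<le> real k * Lbar" by simp
    qed
  qed (intro measurable_sample_loss \<tau> X measurable_const, simp add: space_prob_simplex_space u)
  have g: "(\<integral>X. ?g t X \<partial>Runs) = real k * risk \<tau> u" for t
    by (rule expectation_sample_loss[OF \<tau> u]) (auto simp: inj_def)
  have "real k * (\<Sum>t\<in>{1..T}. (\<integral>X. risk \<tau> (weights_at X \<tau> t) \<partial>Runs)) - real T * (real k * risk \<tau> u) =
    (\<Sum>t\<in>{1..T}. (\<integral>X. ?f t X \<partial>Runs) - (\<integral>X. ?g t X \<partial>Runs))"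
  proof -
    have "(\<Sum>t\<in>{1..T}. (\<integral>X. ?f t X \<partial>Runs)) =
      (\<Sum>t\<in>{1..T}. real k * (\<integral>X. risk \<tau> (weights_at X \<tau> t) \<partial>Runs))"
      by (intro sum.cong refl expectation_round_loss \<tau>) simp
    then show ?thesis by (simp add: sum_subtractf g sum_distrib_left)
  qed
  also have "\<dots> = (\<integral>X. (\<Sum>t\<in>{1..T}. ?f t X - ?g t X) \<partial>Runs)"
    using int_f int_g by simp
  also have "\<dots> \<le> real k * (2 * \<bar>G\<bar> * sqrt (real T * real (card Coords)))"
    using int_f int_g space
    by (intro PR.integral_le_const AE_I2 sample_loss_regret_le \<tau> u) auto
  finally have "real k * (\<Sum>t\<in>{1..T}. (\<integral>X. risk \<tau> (weights_at X \<tau> t) \<partial>Runs)) \<le>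
    real k * (real T * risk \<tau> u + 2 * \<bar>G\<bar> * sqrt (real T * real (card Coords)))"
    by (simp add: algebra_simps)
  then show ?thesis using k by simp
qed

end

subsection \<open>Identification of a nearly best group\<close>

text \<open>By Fubini's theorem; it allows the first component to be treated as a constant in a
  probability bound.\<close>

lemma measure_pair_le:
  assumes "prob_space M" "prob_space N" and A: "A \<in> sets (M \<Otimes>\<^sub>M N)" and "0 \<le> \<beta>"
    and le: "\<And>x. x \<in> space M \<Longrightarrow> measure N (Pair x -` A) \<le> \<beta>"
  shows "measure (M \<Otimes>\<^sub>M N) A \<le> \<beta>"
proof -
  interpret M: prob_space M by fact
  interpret N: prob_space N by fact
  interpret MN: pair_prob_space M N by unfold_locales
  have "emeasure (M \<Otimes>\<^sub>M N) A = (\<integral>\<^sup>+x. emeasure N (Pair x -` A) \<partial>M)"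
    by (rule N.emeasure_pair_measure_alt[OF A])
  also have "\<dots> \<le> (\<integral>\<^sup>+x. ennreal \<beta> \<partial>M)"
    using le by (intro nn_integral_mono) (simp add: N.emeasure_eq_measure ennreal_leI)
  also have "\<dots> = ennreal \<beta>" by (simp add: M.emeasure_space_1)
  finally show ?thesis using \<open>0 \<le> \<beta>\<close> by (simp add: MN.P.emeasure_eq_measure)
qed

context rposst_instance
begin

abbreviation pull_loss ::
    "('t list \<Rightarrow> nat + 't \<Rightarrow> real) \<Rightarrow> (nat \<times> 't list \<times> nat \<Rightarrow> 'p \<times> ('t \<Rightarrow> real)) \<Rightarrow>
      't list \<Rightarrow> nat \<Rightarrow> real" where
  "pull_loss w U \<equiv> (\<lambda>\<tau> s. 1 / (2 * real k * Lbar) * sample_loss \<tau> (w \<tau>) (\<lambda>j. U (s, \<tau>, j)))"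

text \<open>The scaling puts each pull into \<open>{0..1}\<close> with mean
  \<open>risk / (2 * Lbar)\<close>, and pulls with different \<open>s\<close> use disjoint blocks of
  samples. This is Hoeffding's inequality for their sum at deviation
  \<open>n * \<gamma>\<close>.\<close>

lemma pull_concentration:
  assumes \<tau>: "\<tau> \<in> Groups" and w: "w \<tau> \<in> Weights" and "0 < n" "0 \<le> \<gamma>"
  shows "measure Runs {U \<in> space Runs.
      \<gamma> \<le> \<bar>empirical_mean (pull_loss w U) n \<tau> - risk \<tau> (w \<tau>) / (2 * Lbar)\<bar>} \<le>
    2 * exp (- 2 * real n * \<gamma>\<^sup>2)"
proof -
  interpret PR: prob_space Runs by (rule prob_space_PiM_iid)
  define B :: "nat \<Rightarrow> (nat \<times> 't list \<times> nat) set" where "B s = {s} \<times> {\<tau>} \<times> UNIV" for s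
  let ?f = "\<lambda>s U. pull_loss w U \<tau> s"
  have bound: "?f s U \<in> {0..1}" if "U \<in> space Runs" for s U
  proof -
    have "sample_loss \<tau> (w \<tau>) (\<lambda>j. U (s, \<tau>, j)) \<in> {0..real k * Lbar}"
      using that by (intro sample_loss_bounds \<tau> w) (auto simp: space_PiM PiE_iff)
    then show ?thesis
      using k Lbar by (auto simp: divide_le_eq)
  qed
  have ind: "PR.indep_vars (\<lambda>_. borel) ?f {..<n}"
  proof -
    have "PR.indep_vars (\<lambda>s. \<Pi>\<^sub>M i\<in>B s. Psi Q) (\<lambda>s U. restrict (\<lambda>i. U i) (B s)) {..<n}"
      by (rule PR.indep_vars_restrict[OF indep_vars_PiM_iid]) (auto simp: disjoint_family_on_def B_def)
    then have "PR.indep_vars (\<lambda>_. borel) (\<lambda>s U. 1 / (2 * real k * Lbar) *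
        sample_loss \<tau> (w \<tau>) (\<lambda>j. restrict (\<lambda>i. U i) (B s) (s, \<tau>, j))) {..<n}"
    proof (rule PR.indep_vars_compose2)
      fix s
      have "(\<lambda>b. b (s, \<tau>, j)) \<in> (\<Pi>\<^sub>M i\<in>B s. Psi Q) \<rightarrow>\<^sub>M Psi Q" for j
        by (rule measurable_component_singleton) (simp add: B_def)
      then show "(\<lambda>b. 1 / (2 * real k * Lbar) * sample_loss \<tau> (w \<tau>) (\<lambda>j. b (s, \<tau>, j)))
          \<in> borel_measurable (\<Pi>\<^sub>M i\<in>B s. Psi Q)"
        using w by (intro borel_measurable_times borel_measurable_const measurable_sample_loss \<tau>
            measurable_const) (simp_all add: space_prob_simplex_space)
    qed
    then show ?thesis by (simp add: B_def)
  qed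
  define \<mu> where "\<mu> = (\<Sum>s\<in>{..<n}. PR.expectation (?f s))"
  interpret H: Hoeffding_ineq Runs "{..<n}" ?f "\<lambda>_. 0" "\<lambda>_. 1" \<mu>
  proof unfold_locales
    show "AE U in Runs. ?f s U \<in> {0..1}" for s by (intro AE_I2 bound)
    show "PR.indep_vars (\<lambda>_. borel) ?f {..<n}" by (rule ind)
  qed (simp_all add: \<mu>_def)
  have "PR.expectation (?f s) = risk \<tau> (w \<tau>) / (2 * Lbar)" for s
    using expectation_sample_loss[OF \<tau> w, of "\<lambda>j. (s, \<tau>, j)" UNIV] k by (simp add: inj_def)
  then have \<mu>: "\<mu> = real n * (risk \<tau> (w \<tau>) / (2 * Lbar))" by (simp add: \<mu>_def)
  have "measure Runs {U \<in> space Runs. real n * \<gamma> \<le> \<bar>(\<Sum>s<n. ?f s U) - \<mu>\<bar>} \<le>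
    2 * exp (- 2 * (real n * \<gamma>)\<^sup>2 / (\<Sum>s<n. (1 - 0)\<^sup>2))"
    using \<open>0 < n\<close> \<open>0 \<le> \<gamma>\<close> by (intro H.Hoeffding_ineq_abs_ge) auto
  also have "{U \<in> space Runs. real n * \<gamma> \<le> \<bar>(\<Sum>s<n. ?f s U) - \<mu>\<bar>} =
    {U \<in> space Runs. \<gamma> \<le> \<bar>empirical_mean (pull_loss w U) n \<tau> - risk \<tau> (w \<tau>) / (2 * Lbar)\<bar>}"
  proof (intro Collect_cong conj_cong refl)
    fix U
    have "(\<Sum>s<n. ?f s U) - \<mu> = real n * (empirical_mean (pull_loss w U) n \<tau> - risk \<tau> (w \<tau>) / (2 * Lbar))"
      using \<open>0 < n\<close> by (simp add: \<mu> empirical_mean_def right_diff_distrib)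
    then show "real n * \<gamma> \<le> \<bar>(\<Sum>s<n. ?f s U) - \<mu>\<bar> \<longleftrightarrow>
      \<gamma> \<le> \<bar>empirical_mean (pull_loss w U) n \<tau> - risk \<tau> (w \<tau>) / (2 * Lbar)\<bar>"
      using \<open>0 < n\<close> by (simp only: abs_mult) simp
  qed
  finally show ?thesis using \<open>0 < n\<close> by (simp add: power2_eq_square mult_ac)
qed

text \<open>The range covers all groups in all phases, discarded groups included: the samples of all
  pulls exist in advance, so a union bound takes the place of an argument about adaptive
  pulls.\<close>

definition misestimated ::
    "nat \<Rightarrow> real \<Rightarrow> ('t list \<Rightarrow> nat + 't \<Rightarrow> real) \<Rightarrow> (nat \<times> 't list \<times> nat \<Rightarrow> 'p \<times> ('t \<Rightarrow> real)) \<Rightarrow> bool" where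
  "misestimated T2 \<gamma> w U \<longleftrightarrow> (\<exists>\<tau>\<in>Groups. \<exists>j\<in>{1..<card Groups}.
     \<gamma> \<le> \<bar>empirical_mean (pull_loss w U) (sr_pulls (card Groups) T2 j) \<tau> - risk \<tau> (w \<tau>) / (2 * Lbar)\<bar>)"

lemma measurable_pull_loss:
  assumes "\<tau> \<in> Groups" "(\<lambda>x. w x \<tau>) \<in> M \<rightarrow>\<^sub>M prob_simplex_space Coords"
    and "\<And>i. (\<lambda>x. U x i) \<in> M \<rightarrow>\<^sub>M Psi Q"
  shows "(\<lambda>x. pull_loss (w x) (U x) \<tau> s) \<in> borel_measurable M"
  using assms by (intro borel_measurable_times borel_measurable_const measurable_sample_loss)

lemma sets_misestimated:
  assumes w: "\<And>\<tau>. \<tau> \<in> Groups \<Longrightarrow> (\<lambda>x. w x \<tau>) \<in> M \<rightarrow>\<^sub>M prob_simplex_space Coords"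
    and U: "\<And>i. (\<lambda>x. U x i) \<in> M \<rightarrow>\<^sub>M Psi Q"
  shows "{x \<in> space M. misestimated T2 \<gamma> (w x) (U x)} \<in> sets M"
proof -
  have [measurable]: "(\<lambda>x. empirical_mean (pull_loss (w x) (U x)) n \<tau>) \<in> borel_measurable M"
    "(\<lambda>x. risk \<tau> (w x \<tau>)) \<in> borel_measurable M" if "\<tau> \<in> Groups" for n \<tau>
    using measurable_pull_loss[of \<tau> w M U] measurable_risk[of \<tau> "\<lambda>x. w x \<tau>" M] that w U
    unfolding empirical_mean_def by auto
  show ?thesis unfolding misestimated_def using finite_Groups by measurable
qed

text \<open>Union bound over at most \<open>card Groups\<close> squared pairs of group and phase;
  \<open>n\<close>, the number of pulls in phase 1, is a lower bound for every phase.\<close>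

lemma prob_misestimated_le:
  assumes w: "\<forall>\<tau>\<in>Groups. w \<tau> \<in> Weights" and "0 \<le> \<gamma>" "card Groups \<le> T2" "0 < n"
    and n: "n = nat \<lceil>(real T2 - real (card Groups)) / (log_bar (card Groups) * real (card Groups))\<rceil>"
  shows "measure Runs {U \<in> space Runs. misestimated T2 \<gamma> w U} \<le>
    real (card Groups) * (real (card Groups) * (2 * exp (- 2 * real n * \<gamma>\<^sup>2)))"
proof -
  interpret PR: prob_space Runs by (rule prob_space_PiM_iid)
  let ?K = "card Groups"
  let ?A = "\<lambda>x. {U \<in> space Runs. \<gamma> \<le>
    \<bar>empirical_mean (pull_loss w U) (sr_pulls ?K T2 (snd x)) (fst x) - risk (fst x) (w (fst x)) / (2 * Lbar)\<bar>}"
  let ?I = "Groups \<times> {1..<?K}"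
  have meas: "?A x \<in> sets Runs" if "x \<in> ?I" for x
  proof -
    have "(\<lambda>U. pull_loss w U (fst x) s) \<in> borel_measurable Runs" for s
      using that w by (intro measurable_pull_loss) (auto simp: space_prob_simplex_space)
    then have [measurable]: "(\<lambda>U. empirical_mean (pull_loss w U) n (fst x)) \<in> borel_measurable Runs" for n
      unfolding empirical_mean_def by (intro borel_measurable_divide borel_measurable_sum) auto
    show ?thesis by measurable
  qed
  have each: "measure Runs (?A x) \<le> 2 * exp (- 2 * real n * \<gamma>\<^sup>2)" if "x \<in> ?I" for x
  proof -
    have "n \<le> sr_pulls ?K T2 (snd x)"
      unfolding n using that \<open>?K \<le> T2\<close> by (intro sr_pulls_mono) auto
    then have "measure Runs (?A x) \<le> 2 * exp (- 2 * real (sr_pulls ?K T2 (snd x)) * \<gamma>\<^sup>2)"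
      using that \<open>0 < n\<close> by (intro pull_concentration bspec[OF w] \<open>0 \<le> \<gamma>\<close>) auto
    also have "\<dots> \<le> 2 * exp (- 2 * real n * \<gamma>\<^sup>2)"
      using \<open>n \<le> sr_pulls ?K T2 (snd x)\<close> by (simp add: mult_right_mono)
    finally show ?thesis .
  qed
  have "{U \<in> space Runs. misestimated T2 \<gamma> w U} = (\<Union>x\<in>?I. ?A x)"
    unfolding misestimated_def by force
  then have "measure Runs {U \<in> space Runs. misestimated T2 \<gamma> w U} \<le> (\<Sum>x\<in>?I. measure Runs (?A x))"
    using meas finite_Groups by (simp only:) (intro PR.finite_measure_subadditive_finite, auto)
  also have "\<dots> \<le> real (card ?I) * (2 * exp (- 2 * real n * \<gamma>\<^sup>2))"
    by (intro sum_bounded_above each)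
  also have "\<dots> \<le> real (?K * ?K) * (2 * exp (- 2 * real n * \<gamma>\<^sup>2))"
    by (intro mult_right_mono) (simp_all add: card_cartesian_product mult_left_mono)
  finally show ?thesis by simp
qed

text \<open>Hoeffding's bound does not see the weights, so one threshold serves all
  \<open>w\<close>, in particular the random weights produced by the game.\<close>

lemma eventually_prob_misestimated_le:
  assumes "0 < \<gamma>" "0 < \<beta>"
  obtains T where "\<And>T2 w. T \<le> T2 \<Longrightarrow> \<forall>\<tau>\<in>Groups. w \<tau> \<in> Weights \<Longrightarrow>
    measure Runs {U \<in> space Runs. misestimated T2 \<gamma> w U} \<le> \<beta>"
proof -
  define K where "K = real (card Groups)"
  define D where "D = log_bar (card Groups) * K"
  \<comment> \<open>Number of pulls per group that suffices: at the second entry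
    \<open>2 * K * K * exp (- 2 * x * \<gamma>\<^sup>2)\<close> equals \<open>\<beta>\<close>; the
    first ensures at least one pull.\<close>
  define x where "x = max 1 (ln (2 * K * K / \<beta>) / (2 * \<gamma>\<^sup>2))"
  have "0 < K" using finite_Groups Groups_nonempty by (simp add: K_def card_gt_0_iff)
  have "0 < log_bar (card Groups)"
    unfolding log_bar_def by (intro add_pos_nonneg sum_nonneg) auto
  then have "0 < D" using \<open>0 < K\<close> by (simp add: D_def)
  show ?thesis
  proof (rule that)
    fix T2 and w :: "'t list \<Rightarrow> nat + 't \<Rightarrow> real"
    assume T2: "nat \<lceil>K + D * x\<rceil> \<le> T2" and w: "\<forall>\<tau>\<in>Groups. w \<tau> \<in> Weights"
    define n where "n = nat \<lceil>(real T2 - K) / D\<rceil>"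
    have "K + D * x \<le> real T2" using T2 by linarith
    then have "x \<le> (real T2 - K) / D" using \<open>0 < D\<close> by (simp add: field_simps)
    also have "\<dots> \<le> real n" unfolding n_def by linarith
    finally have "x \<le> real n" .
    then have "0 < n" by (simp add: x_def)
    have "0 < D * x" using \<open>0 < D\<close> by (simp add: x_def)
    then have "card Groups \<le> T2" using \<open>K + D * x \<le> real T2\<close> by (simp add: K_def)
    have "ln (2 * K * K / \<beta>) / (2 * \<gamma>\<^sup>2) \<le> real n" using \<open>x \<le> real n\<close> by (simp add: x_def)
    then have "ln (2 * K * K / \<beta>) \<le> 2 * real n * \<gamma>\<^sup>2"
      using \<open>0 < \<gamma>\<close> by (simp add: pos_divide_le_eq algebra_simps)
    then have "2 * K * K / \<beta> \<le> exp (2 * real n * \<gamma>\<^sup>2)"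
      using \<open>0 < K\<close> \<open>0 < \<beta>\<close> by (subst ln_le_cancel_iff[symmetric]) auto
    then have "K * (K * (2 * exp (- 2 * real n * \<gamma>\<^sup>2))) \<le> \<beta>"
      using \<open>0 < \<beta>\<close> by (simp add: exp_minus field_simps)
    then show "measure Runs {U \<in> space Runs. misestimated T2 \<gamma> w U} \<le> \<beta>"
      using prob_misestimated_le[OF w less_imp_le[OF \<open>0 < \<gamma>\<close>] \<open>card Groups \<le> T2\<close> \<open>0 < n\<close>]
      by (simp add: n_def K_def D_def)
  qed
qed

lemma rposst_seq_eq:
  "rposst_seq Q Ch Lbar k N m \<tau>0 T2 (T', X, U) =
    (let w = (\<lambda>\<tau>. weights_at X \<tau> T'); \<tau> = successive_rejects (arm_tie Ch) Groups T2 (pull_loss w U)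
     in (\<tau>, w \<tau>))"
  by (simp add: rposst_seq_def sample_loss_def Let_def)

lemma opt_value_le: "\<tau> \<in> Groups \<Longrightarrow> w \<in> Weights \<Longrightarrow> opt_value Q k N m \<tau>0 \<le> risk \<tau> w"
  and opt_value_nonneg: "0 \<le> opt_value Q k N m \<tau>0"
  and opt_value_approx: "0 < e \<Longrightarrow> \<exists>\<tau>\<in>Groups. \<exists>w\<in>Weights. risk \<tau> w < opt_value Q k N m \<tau>0 + e"
proof -
  let ?V = "(\<lambda>(\<tau>, w). risk \<tau> w) ` (Groups \<times> Weights)"
  have bdd: "bdd_below ?V" using risk_bounds by (intro bdd_belowI[of _ 0]) auto
  \<comment> \<open>Any weights of the algorithm witness that \<open>Weights\<close> is
    nonempty.\<close>
  have "weights_at X \<tau> 0 \<in> Weights" for X \<tau> by (rule weights_at_simplex)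
  then have ne: "?V \<noteq> {}" using Groups_nonempty by auto
  show "opt_value Q k N m \<tau>0 \<le> risk \<tau> w" if "\<tau> \<in> Groups" "w \<in> Weights"
    unfolding opt_value_def using that bdd by (intro cInf_lower) auto
  show "0 \<le> opt_value Q k N m \<tau>0"
    unfolding opt_value_def using ne risk_bounds by (intro cInf_greatest) auto
  show "\<exists>\<tau>\<in>Groups. \<exists>w\<in>Weights. risk \<tau> w < opt_value Q k N m \<tau>0 + e" if "0 < e"
    using cInf_lessD[OF ne, of "opt_value Q k N m \<tau>0 + e"] that by (auto simp: opt_value_def)
qed

end

subsection \<open>The output of the algorithm\<close>

context rposst_instance
begin

abbreviation "final_weights \<omega> \<equiv> (\<lambda>\<tau>. weights_at (fst (snd \<omega>)) \<tau> (fst \<omega>))"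
abbreviation "pulls \<omega> \<equiv> snd (snd \<omega>)"
abbreviation "selected T2 \<omega> \<equiv>
  successive_rejects (arm_tie Ch) Groups T2 (pull_loss (final_weights \<omega>) (pulls \<omega>))"

lemma selected_in: "selected T2 \<omega> \<in> Groups"
  by (intro successive_rejects_in finite_Groups Groups_nonempty arm_tie_in)

lemma near_optimal_rposst_seq_iff:
  "near_optimal Q k N m \<tau>0 \<delta> (rposst_seq Q Ch Lbar k N m \<tau>0 T2 \<omega>) \<longleftrightarrow>
    risk (selected T2 \<omega>) (final_weights \<omega> (selected T2 \<omega>)) \<le> opt_value Q k N m \<tau>0 + \<delta>"
  using selected_in[of T2 \<omega>] weights_at_simplex
  by (cases \<omega>) (simp add: near_optimal_def rposst_seq_eq Let_def)

lemma prob_space_rposst_space: "0 < T1 \<Longrightarrow> prob_space (rposst_space Q T1)"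
  unfolding rposst_space_def
  by (intro prob_space_pair prob_space_PiM_iid prob_space_uniform_count_measure) auto

lemma measurable_pulls: "(\<lambda>\<omega>. pulls \<omega> i) \<in> rposst_space Q T1 \<rightarrow>\<^sub>M Psi Q"
  unfolding rposst_space_def by measurable

lemma measurable_final_weights:
  assumes "\<tau> \<in> Groups"
  shows "(\<lambda>\<omega>. final_weights \<omega> \<tau>) \<in> rposst_space Q T1 \<rightarrow>\<^sub>M prob_simplex_space Coords"
proof -
  have X: "(\<lambda>\<omega>. fst (snd \<omega>) i) \<in> rposst_space Q T1 \<rightarrow>\<^sub>M Psi Q" for i
    unfolding rposst_space_def by measurable
  have "(\<lambda>\<omega>. fst \<omega>) \<in> rposst_space Q T1 \<rightarrow>\<^sub>M count_space {1..T1}"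
    unfolding rposst_space_def by measurable
  then show ?thesis
    by (rule measurable_compose_countable'[rotated]) (auto intro!: measurable_weights_at assms X)
qed

lemma measurable_selected_risk:
  "(\<lambda>\<omega>. risk (selected T2 \<omega>) (final_weights \<omega> (selected T2 \<omega>))) \<in> borel_measurable (rposst_space Q T1)"
proof -
  have "selected T2 \<in> rposst_space Q T1 \<rightarrow>\<^sub>M count_space Groups"
    by (intro measurable_successive_rejects finite_Groups Groups_nonempty arm_tie_in
        measurable_pull_loss measurable_final_weights measurable_pulls)
  from measurable_compose_countable'[OF _ this, of "\<lambda>\<tau> \<omega>. risk \<tau> (final_weights \<omega> \<tau>)" borel]
  show ?thesis
    using measurable_risk[OF _ measurable_final_weights] countable_finite[OF finite_Groups] by auto
qed

text \<open>The uniform number of rounds turns the expectation into an average of the expected risks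
  over rounds; dividing the regret by \<open>T1\<close> leaves
  \<open>sqrt (card Coords / T1)\<close>.\<close>

lemma expectation_final_risk_le:
  assumes "0 < T1" and \<tau>: "\<tau> \<in> Groups" and u: "u \<in> Weights"
  shows "(\<integral>\<omega>. risk \<tau> (final_weights \<omega> \<tau>) \<partial>rposst_space Q T1) \<le>
    risk \<tau> u + 2 * \<bar>G\<bar> * sqrt (real (card Coords) / real T1)"
proof -
  let ?T = "uniform_count_measure {1..T1}"
  interpret T: prob_space ?T using \<open>0 < T1\<close> by (intro prob_space_uniform_count_measure) auto
  interpret R: prob_space Runs by (rule prob_space_PiM_iid)
  interpret RR: pair_prob_space Runs Runs by unfold_locales
  interpret TRR: pair_prob_space ?T "Runs \<Otimes>\<^sub>M Runs" by unfold_locales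
  have int: "integrable (?T \<Otimes>\<^sub>M (Runs \<Otimes>\<^sub>M Runs)) (\<lambda>\<omega>. risk \<tau> (final_weights \<omega> \<tau>))"
    using integrable_risk[OF prob_space_rposst_space[OF \<open>0 < T1\<close>] \<tau> measurable_final_weights[OF \<tau>]]
    by (simp add: rposst_space_def)
  have int': "integrable (Runs \<Otimes>\<^sub>M Runs) (\<lambda>x. risk \<tau> (weights_at (fst x) \<tau> t))" for t
    by (intro integrable_risk RR.prob_space_axioms \<tau> measurable_weights_at) measurable
  have "(\<integral>\<omega>. risk \<tau> (final_weights \<omega> \<tau>) \<partial>rposst_space Q T1) =
    (\<integral>t. (\<integral>x. risk \<tau> (weights_at (fst x) \<tau> t) \<partial>(Runs \<Otimes>\<^sub>M Runs)) \<partial>?T)"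
    using TRR.integral_fst'[OF int] by (simp add: rposst_space_def)
  also have "\<dots> = (\<integral>t. (\<integral>X. risk \<tau> (weights_at X \<tau> t) \<partial>Runs) \<partial>?T)"
    using RR.integral_fst'[OF int'] by (simp add: R.prob_space)
  also have "\<dots> = (\<Sum>t\<in>{1..T1}. (\<integral>X. risk \<tau> (weights_at X \<tau> t) \<partial>Runs)) / real T1"
    by (subst integral_uniform_count_measure) auto
  also have "\<dots> \<le> (real T1 * risk \<tau> u + 2 * \<bar>G\<bar> * sqrt (real T1 * real (card Coords))) / real T1"
    by (intro divide_right_mono sum_expected_risk_le \<tau> u) simp
  also have "sqrt (real T1 * real (card Coords)) = real T1 * sqrt (real (card Coords) / real T1)"
    using \<open>0 < T1\<close> by (simp add: real_sqrt_mult real_sqrt_divide real_div_sqrt field_simps)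
  also have "(real T1 * risk \<tau> u + 2 * \<bar>G\<bar> * (real T1 * sqrt (real (card Coords) / real T1))) / real T1 =
    risk \<tau> u + 2 * \<bar>G\<bar> * sqrt (real (card Coords) / real T1)"
    using \<open>0 < T1\<close> by (simp add: field_simps)
  finally show ?thesis .
qed

text \<open>In units of pulls Successive Rejects loses at most
  \<open>2 * \<gamma> * card Groups\<close>; one such unit is \<open>2 * Lbar\<close> of
  risk.\<close>

lemma selected_risk_le:
  assumes "\<not> misestimated T2 \<gamma> (final_weights \<omega>) (pulls \<omega>)" "0 \<le> \<gamma>" "\<tau> \<in> Groups"
  shows "risk (selected T2 \<omega>) (final_weights \<omega> (selected T2 \<omega>)) \<le>
    risk \<tau> (final_weights \<omega> \<tau>) + 4 * \<gamma> * real (card Groups) * Lbar"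
proof -
  let ?\<mu> = "\<lambda>\<tau>. risk \<tau> (final_weights \<omega> \<tau>) / (2 * Lbar)"
  let ?e = "\<lambda>j. empirical_mean (pull_loss (final_weights \<omega>) (pulls \<omega>)) (sr_pulls (card Groups) T2 j)"
  have close: "\<bar>?e j a - ?\<mu> a\<bar> \<le> \<gamma>" if "1 \<le> j" "j < card Groups" "a \<in> Groups" for j a
  proof (rule ccontr)
    assume "\<not> \<bar>?e j a - ?\<mu> a\<bar> \<le> \<gamma>"
    then have "\<gamma> \<le> \<bar>?e j a - ?\<mu> a\<bar>" by linarith
    moreover have "j \<in> {1..<card Groups}" using that by simp
    ultimately show False using assms(1) that(3) unfolding misestimated_def by blast
  qed
  have "risk (selected T2 \<omega>) (final_weights \<omega> (selected T2 \<omega>)) / (2 * Lbar) \<le>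
    risk \<tau> (final_weights \<omega> \<tau>) / (2 * Lbar) + 2 * \<gamma> * real (card Groups)"
    using assms(2,3)
    by (intro successive_rejects_near_best[where \<mu> = ?\<mu>]
        finite_Groups Groups_nonempty arm_tie_in close)
  then show ?thesis using Lbar by (simp add: field_simps)
qed

text \<open>Given the number of rounds and the samples of the game, the weights are constants and
  only the pulls are random; hence two applications of \<open>measure_pair_le\<close>.\<close>

lemma prob_rposst_misestimated_le:
  assumes "0 < T1" "0 \<le> \<beta>"
    and le: "\<And>w. \<forall>\<tau>\<in>Groups. w \<tau> \<in> Weights \<Longrightarrow>
      measure Runs {U \<in> space Runs. misestimated T2 \<gamma> w U} \<le> \<beta>"
  shows "measure (rposst_space Q T1)
    {\<omega> \<in> space (rposst_space Q T1). misestimated T2 \<gamma> (final_weights \<omega>) (pulls \<omega>)} \<le> \<beta>"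
    (is "measure _ ?A \<le> _")
proof -
  let ?T = "uniform_count_measure {1..T1}"
  have T: "prob_space ?T" using \<open>0 < T1\<close> by (intro prob_space_uniform_count_measure) auto
  have R: "prob_space Runs" by (rule prob_space_PiM_iid)
  have RR: "prob_space (Runs \<Otimes>\<^sub>M Runs)" by (intro prob_space_pair R)
  have A: "?A \<in> sets (?T \<Otimes>\<^sub>M (Runs \<Otimes>\<^sub>M Runs))"
    unfolding rposst_space_def[symmetric]
    by (intro sets_misestimated measurable_final_weights measurable_pulls)
  have "measure (?T \<Otimes>\<^sub>M (Runs \<Otimes>\<^sub>M Runs)) ?A \<le> \<beta>"
  proof (rule measure_pair_le[OF T RR A \<open>0 \<le> \<beta>\<close>])
    fix t assume t: "t \<in> space ?T"
    show "measure (Runs \<Otimes>\<^sub>M Runs) (Pair t -` ?A) \<le> \<beta>"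
    proof (rule measure_pair_le[OF R R sets_Pair1[OF A] \<open>0 \<le> \<beta>\<close>])
      fix X assume "X \<in> space Runs"
      then have "Pair X -` Pair t -` ?A =
        {U \<in> space Runs. misestimated T2 \<gamma> (\<lambda>\<tau>. weights_at X \<tau> t) U}"
        using t by (auto simp: rposst_space_def space_pair_measure)
      then show "measure Runs (Pair X -` Pair t -` ?A) \<le> \<beta>"
        using le[of "\<lambda>\<tau>. weights_at X \<tau> t"] weights_at_simplex by simp
    qed
  qed
  then show ?thesis by (simp add: rposst_space_def)
qed

text \<open>
  How large \<open>T2\<close> must be can be chosen independently of \<open>q\<close> because the claim is
  trivial when \<open>q\<close> is so small that the tolerance exceeds \<open>Lbar\<close>.
\<close>

lemma prob_near_optimal_ge:
  fixes T1 :: nat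
  assumes "0 < T1"
  defines "\<epsilon>0 \<equiv> (1 + 2 * \<bar>G\<bar> * sqrt (1 + real (card \<tau>0))) * sqrt (1 / real T1 * real m)"
  shows "\<exists>T. \<forall>T2 q \<delta>. T \<le> T2 \<and> 0 < q \<and> q \<le> 1 \<and> 4 * \<epsilon>0 / q \<le> \<delta> \<longrightarrow>
    1 - q \<le> measure (rposst_space Q T1) {\<omega> \<in> space (rposst_space Q T1).
      near_optimal Q k N m \<tau>0 \<delta> (rposst_seq Q Ch Lbar k N m \<tau>0 T2 \<omega>)}"
proof -
  let ?M = "rposst_space Q T1"
  let ?opt = "opt_value Q k N m \<tau>0"
  interpret M: prob_space ?M by (rule prob_space_rposst_space) fact
  define K where "K = real (card Groups)"
  have "0 < K" using finite_Groups Groups_nonempty by (simp add: K_def card_gt_0_iff)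
  have s: "0 < sqrt (1 / real T1 * real m)" using \<open>0 < T1\<close> m by simp
  then have "0 < \<epsilon>0" unfolding \<epsilon>0_def by (intro mult_pos_pos add_pos_nonneg) auto
  \<comment> \<open>Chosen so that the loss \<open>4 * \<gamma> * K * Lbar\<close> of Successive
    Rejects equals \<open>2 * \<epsilon>0\<close>, at most half of \<open>\<delta>\<close>.\<close>
  define \<gamma> where "\<gamma> = \<epsilon>0 / (2 * K * Lbar)"
  have "0 < \<gamma>" using \<open>0 < \<epsilon>0\<close> \<open>0 < K\<close> Lbar by (simp add: \<gamma>_def)
  \<comment> \<open>In the nontrivial case \<open>\<delta> < Lbar\<close> the tolerance condition
    gives \<open>4 * \<epsilon>0 \<le> Lbar * q\<close>, hence \<open>\<beta> \<le> q / 2\<close>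
    although \<open>\<beta>\<close> does not mention \<open>q\<close>.\<close>
  define \<beta> where "\<beta> = 2 * \<epsilon>0 / Lbar"
  have "0 < \<beta>" using \<open>0 < \<epsilon>0\<close> Lbar by (simp add: \<beta>_def)
  obtain T where T: "\<And>T2 w. T \<le> T2 \<Longrightarrow> \<forall>\<tau>\<in>Groups. w \<tau> \<in> Weights \<Longrightarrow>
      measure Runs {U \<in> space Runs. misestimated T2 \<gamma> w U} \<le> \<beta>"
    using eventually_prob_misestimated_le[OF \<open>0 < \<gamma>\<close> \<open>0 < \<beta>\<close>] by blast
  \<comment> \<open>The infimum comes without a minimizer, so the comparator is only nearly optimal;
    its slack \<open>sqrt (m / T1)\<close> is the summand \<open>1\<close> in the constant of
    \<open>\<epsilon>0\<close>.\<close>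
  obtain \<tau> u where \<tau>: "\<tau> \<in> Groups" and u: "u \<in> Weights"
    and opt: "risk \<tau> u < ?opt + sqrt (1 / real T1 * real m)"
    using opt_value_approx[OF s] by blast
  let ?R = "\<lambda>\<omega>. risk \<tau> (final_weights \<omega> \<tau>)"
  have int: "integrable ?M ?R"
    by (intro integrable_risk M.prob_space_axioms \<tau> measurable_final_weights)
  \<comment> \<open>Absorbs the mandatory test cases into the constant:
    \<open>m + card \<tau>0 \<le> (1 + card \<tau>0) * m\<close> for
    \<open>m \<ge> 1\<close>.\<close>
  have "sqrt (real (card Coords) / real T1) \<le>
    sqrt ((1 + real (card \<tau>0)) * (1 / real T1 * real m))"
  proof (intro real_sqrt_le_mono)
    have "real (card \<tau>0) \<le> real (card \<tau>0) * real m" using m by (simp add: mult_le_cancel_left1)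
    then have "real (card Coords) \<le> (1 + real (card \<tau>0)) * real m"
      by (simp add: card_Coords algebra_simps)
    then show "real (card Coords) / real T1 \<le> (1 + real (card \<tau>0)) * (1 / real T1 * real m)"
      using \<open>0 < T1\<close> by (simp add: divide_right_mono)
  qed
  then have "2 * \<bar>G\<bar> * sqrt (real (card Coords) / real T1) \<le>
    2 * \<bar>G\<bar> * (sqrt (1 + real (card \<tau>0)) * sqrt (1 / real T1 * real m))"
    unfolding real_sqrt_mult by (intro mult_left_mono) auto
  then have exp: "(\<integral>\<omega>. ?R \<omega> - ?opt \<partial>?M) \<le> \<epsilon>0"
    using expectation_final_risk_le[OF \<open>0 < T1\<close> \<tau> u] opt int
    by (simp add: M.prob_space \<epsilon>0_def algebra_simps)
  show ?thesis
  proof (intro exI[of _ T] allI impI)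
    fix T2 :: nat and q \<delta> :: real
    assume "T \<le> T2 \<and> 0 < q \<and> q \<le> 1 \<and> 4 * \<epsilon>0 / q \<le> \<delta>"
    then have "T \<le> T2" and q: "0 < q" "q \<le> 1" and \<delta>: "4 * \<epsilon>0 / q \<le> \<delta>" by auto
    let ?S = "\<lambda>\<omega>. risk (selected T2 \<omega>) (final_weights \<omega> (selected T2 \<omega>))"
    let ?E = "{\<omega> \<in> space ?M. ?S \<omega> \<le> ?opt + \<delta>}"
    let ?far = "{\<omega> \<in> space ?M. \<delta> / 2 \<le> ?R \<omega> - ?opt}"
    let ?mis = "{\<omega> \<in> space ?M. misestimated T2 \<gamma> (final_weights \<omega>) (pulls \<omega>)}"
    have E: "?E \<in> sets ?M" using measurable_selected_risk by measurable
    have "1 - q \<le> measure ?M ?E"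
    proof (cases "Lbar \<le> \<delta>")
      case True
      have "?S \<omega> \<le> ?opt + \<delta>" for \<omega>
        using risk_bounds[OF selected_in[of T2 \<omega>] weights_at_simplex] opt_value_nonneg True
        by (simp add: add_increasing order_trans[of _ Lbar])
      then have "?E = space ?M" by simp
      then show ?thesis using q by (simp add: M.prob_space)
    next
      case False
      have "4 * \<epsilon>0 \<le> \<delta> * q" using \<delta> q by (simp add: pos_divide_le_eq)
      also have "\<dots> \<le> Lbar * q" using False q by (intro mult_right_mono) auto
      finally have "\<beta> \<le> q / 2" using Lbar by (simp add: \<beta>_def field_simps)
      have "4 * \<epsilon>0 \<le> 4 * \<epsilon>0 / q" using q \<open>0 < \<epsilon>0\<close> by (simp add: field_simps)
      then have "4 * \<epsilon>0 \<le> \<delta>" using \<delta> by simp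
      then have "0 < \<delta>" using \<open>0 < \<epsilon>0\<close> by simp
      have far: "?far \<in> sets ?M" using borel_measurable_integrable[OF int] by measurable
      have mis: "?mis \<in> sets ?M" by (intro sets_misestimated measurable_final_weights measurable_pulls)
      \<comment> \<open>Markov's inequality applies because the excess is nonnegative: the final
        weights of \<open>\<tau>\<close> compete in the infimum. Half of \<open>\<delta>\<close> and
        half of \<open>q\<close> produce the factor in \<open>4 * \<epsilon>0\<close>.\<close>
      have "measure ?M ?far \<le> (\<integral>\<omega>. ?R \<omega> - ?opt \<partial>?M) / (\<delta> / 2)"
        using int \<open>0 < \<delta>\<close> opt_value_le[OF \<tau> weights_at_simplex] \<tau>
        by (intro integral_Markov_inequality_measure[where A="{}"]) auto
      also have "\<dots> \<le> \<epsilon>0 / (\<delta> / 2)" using exp \<open>0 < \<delta>\<close> by (intro divide_right_mono) auto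
      also have "\<dots> \<le> q / 2" using \<open>4 * \<epsilon>0 \<le> \<delta> * q\<close> \<open>0 < \<delta>\<close> by (simp add: field_simps)
      finally have p_far: "measure ?M ?far \<le> q / 2" .
      have "measure ?M ?mis \<le> \<beta>"
        using T[OF \<open>T \<le> T2\<close>] \<open>0 < \<beta>\<close> by (intro prob_rposst_misestimated_le \<open>0 < T1\<close>) auto
      then have p_mis: "measure ?M ?mis \<le> q / 2" using \<open>\<beta> \<le> q / 2\<close> by simp
      have "4 * \<gamma> * K * Lbar = 2 * \<epsilon>0" using \<open>0 < K\<close> Lbar by (simp add: \<gamma>_def)
      have "space ?M - ?E \<subseteq> ?far \<union> ?mis"
      proof
        fix \<omega> assume \<omega>: "\<omega> \<in> space ?M - ?E"
        show "\<omega> \<in> ?far \<union> ?mis"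
        proof (rule ccontr)
          assume "\<omega> \<notin> ?far \<union> ?mis"
          then have "\<not> misestimated T2 \<gamma> (final_weights \<omega>) (pulls \<omega>)" "?R \<omega> - ?opt < \<delta> / 2"
            using \<omega> by auto
          moreover from this have "?S \<omega> \<le> ?R \<omega> + 4 * \<gamma> * K * Lbar"
            unfolding K_def using \<tau> \<open>0 < \<gamma>\<close> by (intro selected_risk_le) auto
          ultimately have "?S \<omega> \<le> ?opt + \<delta>"
            using \<open>4 * \<gamma> * K * Lbar = 2 * \<epsilon>0\<close> \<open>4 * \<epsilon>0 \<le> \<delta>\<close> by linarith
          then show False using \<omega> by simp
        qed
      qed
      then have "measure ?M (space ?M - ?E) \<le> measure ?M (?far \<union> ?mis)"
        using far mis by (intro M.finite_measure_mono) auto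
      also have "\<dots> \<le> measure ?M ?far + measure ?M ?mis"
        using far mis by (rule measure_Un_le)
      finally show ?thesis using p_far p_mis M.prob_compl[OF E] by simp
    qed
    then show "1 - q \<le> measure ?M {\<omega> \<in> space ?M.
        near_optimal Q k N m \<tau>0 \<delta> (rposst_seq Q Ch Lbar k N m \<tau>0 T2 \<omega>)}"
      unfolding near_optimal_rposst_seq_iff .
  qed
qed

end

theorem theorem4p1:
  fixes G Lbar :: real and s0 :: nat
  assumes "0 < Lbar"
  shows "\<exists>C>0. \<forall>(Q :: ('t, 'p) problem) (Ch :: ('t, 'p) choices) (k::nat) (N::nat) (m::nat) (\<tau>0 :: 't set).
    valid_problem Q \<and> losses_bounded Q Lbar \<and> valid_choices Q m \<tau>0 G Ch \<and>
    \<tau>0 \<subseteq> tests Q \<and> card \<tau>0 = s0 \<and> 1 \<le> k \<and> k \<le> N \<and> 1 \<le> m \<longrightarrow>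
    (\<forall>T1>0. \<exists>\<alpha> :: nat \<Rightarrow> real.
       (\<forall>T2. 0 < \<alpha> T2) \<and> \<alpha> \<in> O(\<lambda>T2. exp (- real T2)) \<and>
       (\<forall>(p::real) (q::real) (T2::nat). 0 < p \<and> p \<le> 1 \<and> 0 < q \<and> q \<le> 1 \<longrightarrow>
          (let \<epsilon> = C * (sqrt (1 / real T1 * real m) + sqrt (1 / real T1 * ln (1 / p)))
           in (1 - p) * (1 - q) * (1 - \<alpha> T2) \<le>
                measure (rposst_space Q T1)
                  {\<omega> \<in> space (rposst_space Q T1).
                     near_optimal Q k N m \<tau>0 (\<epsilon> / q) (rposst_seq Q Ch Lbar k N m \<tau>0 T2 \<omega>)})))"
proof -
  \<comment> \<open>\<open>C\<close> is fixed before the instance and sees only \<open>G\<close> and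
    \<open>s0\<close>; \<open>\<bar>G\<bar>\<close> keeps it positive before any instance forces
    \<open>G \<ge> 0\<close>. The factor \<open>4\<close> is that of
    \<open>prob_near_optimal_ge\<close>.\<close>
  define C where "C = 4 * (1 + 2 * \<bar>G\<bar> * sqrt (1 + real s0))"
  have "0 < 1 + 2 * \<bar>G\<bar> * sqrt (1 + real s0)" by (intro add_pos_nonneg) auto
  then have "0 < C" by (simp add: C_def)
  show ?thesis
  proof (intro exI[of _ C] conjI allI impI \<open>0 < C\<close>)
    fix Q :: "('t, 'p) problem" and Ch :: "('t, 'p) choices" and k N m :: nat and \<tau>0 :: "'t set"
      and T1 :: nat
    assume Q: "valid_problem Q \<and> losses_bounded Q Lbar \<and> valid_choices Q m \<tau>0 G Ch \<and>
      \<tau>0 \<subseteq> tests Q \<and> card \<tau>0 = s0 \<and> 1 \<le> k \<and> k \<le> N \<and> 1 \<le> m" and T1: "0 < T1"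
    interpret rposst_instance Q Ch G Lbar k N m \<tau>0
      using Q assms by unfold_locales auto
    let ?P = "\<lambda>\<delta> T2. measure (rposst_space Q T1) {\<omega> \<in> space (rposst_space Q T1).
      near_optimal Q k N m \<tau>0 \<delta> (rposst_seq Q Ch Lbar k N m \<tau>0 T2 \<omega>)}"
    have C_eq: "C * sqrt (1 / real T1 * real m) =
        4 * ((1 + 2 * \<bar>G\<bar> * sqrt (1 + real (card \<tau>0))) * sqrt (1 / real T1 * real m))"
      using Q by (simp add: C_def)
    have "\<exists>T. \<forall>T2 q \<delta>. T \<le> T2 \<and> 0 < q \<and> q \<le> 1 \<and>
        C * sqrt (1 / real T1 * real m) / q \<le> \<delta> \<longrightarrow> 1 - q \<le> ?P \<delta> T2"
      unfolding C_eq by (rule prob_near_optimal_ge[OF T1])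
    then obtain T where T: "\<forall>T2 q \<delta>. T \<le> T2 \<and> 0 < q \<and> q \<le> 1 \<and>
        C * sqrt (1 / real T1 * real m) / q \<le> \<delta> \<longrightarrow> 1 - q \<le> ?P \<delta> T2" ..
    \<comment> \<open>Below \<open>T\<close> the value \<open>1\<close> makes the claimed lower
      bound \<open>0\<close>. From \<open>T\<close> on the bound \<open>1 - q\<close> already holds,
      and \<open>exp (- T2)\<close> keeps \<open>\<alpha>\<close> positive and of the required
      order.\<close>
    define \<alpha> where "\<alpha> T2 = (if T2 < T then 1 else exp (- real T2))" for T2
    have "\<alpha> \<in> O(\<lambda>T2. exp (- real T2))"
    proof (rule landau_o.bigI[of 1])
      show "eventually (\<lambda>T2. norm (\<alpha> T2) \<le> 1 * norm (exp (- real T2))) sequentially"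
        using eventually_ge_at_top[of T] by eventually_elim (simp add: \<alpha>_def)
    qed simp
    moreover have "(1 - p) * (1 - q) * (1 - \<alpha> T2) \<le>
      ?P (C * (sqrt (1 / real T1 * real m) + sqrt (1 / real T1 * ln (1 / p))) / q) T2"
      if pq: "0 < p" "p \<le> 1" "0 < q" "q \<le> 1" for p q :: real and T2
    proof (cases "T2 < T")
      case True
      then show ?thesis by (simp add: \<alpha>_def)
    next
      case False
      have "0 \<le> ln (1 / p)" using pq by simp
      then have "C * sqrt (1 / real T1 * real m) / q \<le>
        C * (sqrt (1 / real T1 * real m) + sqrt (1 / real T1 * ln (1 / p))) / q"
        using pq \<open>0 < C\<close> by (intro divide_right_mono mult_left_mono) auto
      then have "1 - q \<le> ?P (C * (sqrt (1 / real T1 * real m) + sqrt (1 / real T1 * ln (1 / p))) / q) T2"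
        using False pq by (intro T[rule_format]) auto
      moreover have "(1 - p) * (1 - q) * (1 - \<alpha> T2) \<le> 1 * (1 - q) * 1"
        using pq by (intro mult_mono) (auto simp: \<alpha>_def)
      ultimately show ?thesis by simp
    qed
    ultimately show "\<exists>\<alpha> :: nat \<Rightarrow> real.
       (\<forall>T2. 0 < \<alpha> T2) \<and> \<alpha> \<in> O(\<lambda>T2. exp (- real T2)) \<and>
       (\<forall>(p::real) (q::real) (T2::nat). 0 < p \<and> p \<le> 1 \<and> 0 < q \<and> q \<le> 1 \<longrightarrow>
          (let \<epsilon> = C * (sqrt (1 / real T1 * real m) + sqrt (1 / real T1 * ln (1 / p)))
           in (1 - p) * (1 - q) * (1 - \<alpha> T2) \<le> ?P (\<epsilon> / q) T2))"
      by (intro exI[of _ \<alpha>]) (auto simp: Let_def \<alpha>_def)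
  qed
qed

end
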